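(* Let $X$ be the subshift obtained from the marker construction described in the context, and $\mu$ its unique shift-invariant probability measure. For $x\in X$ and $n\in\mathbb{N}$ let $R_n(x) = \inf\{k>0 : x_{[k,k+n)} = x_{[0,n)}\}$ (finite by minimality). Then: (1) For $\mu$-a.e. $x\in X$, the quantity $\limsup_{n\to\infty}\frac{1}{n^{\beta}}\log R_n(x)$, as a function of $\beta>0$, has critical value $1/2$. (2) There is a set $\hat X\subset X$ with $\mu(\hat X)=1$ such that for every $\tau\in[0,1/2]$ there is an increasing sequence $(n_j)_{j\in\mathbb{N}}$ such that for each $x\in\hat X$, the quantity $\lim_{j\to\infty}\frac{1}{(n_j)^{\beta}}\log R_{n_j}(x)$, as a function of $\beta>0$, has critical value $\tau$.
   Context: Marker construction. Let $l_1$ be a sufficiently large perfect square and $N_1 = 2^{\sqrt{l_1}}$. Let $\mathcal{C}_1$ be a set of $N_1$ binary words of length $l_1$, each beginning with $001$, such that the word $00$ occurs in each element of $\mathcal{C}_1$ only as its prefix. Inductively, given a set $\mathcal{C}_j$ of $N_j$ distinct words of length $l_j$ with an ordering $\mathcal{C}_j = \{u_1^{(j)},\dots,u_{N_j}^{(j)}\}$, let $P_j = \{2\}\cup\{i^2 : 2 \le i \le \lfloor\sqrt{N_j}\rfloor\}$, and let $\mathcal{C}_{j+1}$ be the set of all words $u^{(j)}_{\pi(1)}\cdots u^{(j)}_{\pi(N_j)}$ where $\pi$ ranges over permutations of $\{1,\dots,N_j\}$ fixing every element outside $P_j$. Thus $N_{j+1} = (\lfloor\sqrt{N_j}\rfloor)!$,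 $l_{j+1} = l_j N_j$. The ordering of $\mathcal{C}_{j+1}$ is arbitrary except that its first element is $u_1^{(j)}u_2^{(j)}\cdots u_{N_j}^{(j)}$. $X \subset \{0,1\}^{\mathbb{Z}}$ is the set of bi-infinite sequences each finite subword of which is a subword of some word in $\bigcup_j \mathcal{C}_j$; it is strictly ergodic. Critical value: for a family of quantities $F(\beta)\in[0,\infty]$ indexed by $\beta>0$, we say $F$ has critical value $c$ if $F(\beta) = \infty$ for all $0<\beta<c$ and $F(\beta) = 0$ for all $\beta > c$ (for $c=0$: $F(\beta)=0$ for all $\beta>0$). *)

theory Defs
  imports "HOL-Probability.Probability" "HOL-Combinatorics.Permutations" "HOL-Library.Sublist"
begin

text \<open>Levels are 0-indexed here: Isabelle level j corresponds to level j+1 of the paper.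
  Words are lists of booleans (False = 0, True = 1).\<close>

definition isqrt :: "nat \<Rightarrow> nat" where
  "isqrt N = nat \<lfloor>sqrt (real N)\<rfloor>"

text \<open>N_j: number of words at level j (paper: N_1 = 2^sqrt(l_1), N_{j+1} = (floor sqrt N_j)!)\<close>
fun Nseq :: "nat \<Rightarrow> nat \<Rightarrow> nat" where
  "Nseq l1 0 = 2 ^ isqrt l1"
| "Nseq l1 (Suc j) = fact (isqrt (Nseq l1 j))"

definition Pset :: "nat \<Rightarrow> nat set" where
  "Pset N = {2} \<union> {i^2 | i. 2 \<le> i \<and> i \<le> isqrt N}"

text \<open>C_{j+1} from the ordering w of C_j (w i = u_i, 1 \<le> i \<le> N)\<close>
definition next_words :: "(nat \<Rightarrow> bool list) \<Rightarrow> nat \<Rightarrow> bool list set" where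
  "next_words w N = {concat (map (w \<circ> \<pi>) [1..<N+1]) | \<pi>.
      \<pi> permutes {1..N} \<and> (\<forall>i\<in>{1..N}. i \<notin> Pset N \<longrightarrow> \<pi> i = i)}"

definition zz_only_prefix :: "bool list \<Rightarrow> bool" where
  "zz_only_prefix w \<longleftrightarrow> (\<forall>k. Suc k < length w \<and> w ! k = False \<and> w ! Suc k = False \<longrightarrow> k = 0)"

text \<open>u j i = i-th element (1 \<le> i \<le> N_j) of the ordered set C_j.\<close>
definition marker_construction :: "nat \<Rightarrow> (nat \<Rightarrow> nat \<Rightarrow> bool list) \<Rightarrow> bool" where
  "marker_construction l1 u \<longleftrightarrow>
     (\<exists>s. l1 = s^2) \<and>
     inj_on (u 0) {1..Nseq l1 0} \<and>
     (\<forall>i\<in>{1..Nseq l1 0}. length (u 0 i) = l1 \<and> take 3 (u 0 i) = [False, False, True]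
                           \<and> zz_only_prefix (u 0 i)) \<and>
     (\<forall>j. bij_betw (u (Suc j)) {1..Nseq l1 (Suc j)} (next_words (u j) (Nseq l1 j)) \<and>
          u (Suc j) 1 = concat (map (u j) [1..<Nseq l1 j + 1]))"

definition marker_language :: "nat \<Rightarrow> (nat \<Rightarrow> nat \<Rightarrow> bool list) \<Rightarrow> bool list set" where
  "marker_language l1 u = {v. \<exists>j i. i \<in> {1..Nseq l1 j} \<and> sublist v (u j i)}"

definition marker_subshift :: "nat \<Rightarrow> (nat \<Rightarrow> nat \<Rightarrow> bool list) \<Rightarrow> (int \<Rightarrow> bool) set" where
  "marker_subshift l1 u = {x. \<forall>(a::int) (n::nat). map (\<lambda>k. x (a + int k)) [0..<n] \<in> marker_language l1 u}"

definition shift :: "(int \<Rightarrow> bool) \<Rightarrow> (int \<Rightarrow> bool)" where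
  "shift x = (\<lambda>k. x (k + 1))"

definition return_time :: "(int \<Rightarrow> bool) \<Rightarrow> nat \<Rightarrow> nat" where
  "return_time x n = (LEAST k. 0 < k \<and> (\<forall>i<n. x (int k + int i) = x (int i)))"

definition has_critical_value :: "(real \<Rightarrow> ereal) \<Rightarrow> real \<Rightarrow> bool" where
  "has_critical_value F c \<longleftrightarrow> (\<forall>\<beta>. 0 < \<beta> \<and> \<beta> < c \<longrightarrow> F \<beta> = \<infinity>) \<and> (\<forall>\<beta>. \<beta> > c \<longrightarrow> F \<beta> = 0)"

definition has_critical_value_lim :: "(real \<Rightarrow> nat \<Rightarrow> ereal) \<Rightarrow> real \<Rightarrow> bool" where
  "has_critical_value_lim s c \<longleftrightarrow>
     (\<forall>\<beta>. 0 < \<beta> \<and> \<beta> < c \<longrightarrow> (s \<beta> \<longlonglongrightarrow> \<infinity>)) \<and> (\<forall>\<beta>. \<beta> > c \<longrightarrow> (s \<beta> \<longlonglongrightarrow> 0))"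

end

theory Submission
  imports Defs "HOL-Real_Asymp.Real_Asymp"
begin

text \<open>
  Write \<open>l j\<close> and \<open>N j\<close> for the length and the number of the words of level \<open>j\<close>. Since
  \<open>ln (fact m)\<close> is about \<open>m * ln m\<close>, the quotient of \<open>ln (N j)\<close> and \<open>sqrt (l j)\<close> lies between
  \<open>1 / (2 * 8 ^ j)\<close> and \<open>1\<close>, while \<open>l j\<close> grows faster than every \<open>C ^ j\<close>.

  Upper bound: \<open>m\<close> consecutive indices contain at most \<open>sqrt m + 1\<close> squares, so a word of length
  \<open>n\<close> with \<open>l j \<le> n < l (j + 1)\<close> involves only about \<open>sqrt (n / l j)\<close> free choices of words of level
  \<open>j\<close>; hence there are at most \<open>exp (15 * sqrt n)\<close> words of length \<open>n\<close>. Points not returning up to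
  time \<open>T\<close> have pairwise different \<open>n\<close>-words along an orbit segment of length \<open>T\<close>, so by invariance they
  have measure at most \<open>exp (15 * sqrt n) / T\<close>, and Borel-Cantelli applies.

  Exact return times: almost every point lies, for all large \<open>j\<close>, in a long run of blocks of level
  \<open>j\<close> that no permutation moves. Recognizability of the blocks then forces the return time to be
  exactly \<open>l (j + 1)\<close> for all \<open>n\<close> from \<open>2 * l j\<close> up to more than any fixed power of \<open>l j\<close>. As
  \<open>ln (l (j + 1))\<close> is roughly \<open>sqrt (l j)\<close>, taking \<open>n\<close> near \<open>l j powr (1 / (2 * \<tau>))\<close> gives the
  critical value \<open>\<tau>\<close>.
\<close>

subsection \<open>Growth of the number and the length of the words\<close>

text \<open>\<open>lseq l1 j\<close> is the length of the words of level \<open>j\<close>, which is \<open>l_{j+1}\<close> in the paper.\<close>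
primrec lseq :: "nat \<Rightarrow> nat \<Rightarrow> nat" where
  "lseq l1 0 = l1"
| "lseq l1 (Suc j) = lseq l1 j * Nseq l1 j"

lemma le_isqrt_iff: "k \<le> isqrt n \<longleftrightarrow> k\<^sup>2 \<le> n"
proof -
  have "k \<le> isqrt n \<longleftrightarrow> real k \<le> sqrt (real n)"
    unfolding isqrt_def by (simp add: le_nat_floor le_nat_iff le_floor_iff)
  also have "\<dots> \<longleftrightarrow> real (k\<^sup>2) \<le> real n"
    by (metis of_nat_0_le_iff of_nat_power real_le_rsqrt real_sqrt_le_iff real_sqrt_pow2 real_sqrt_power)
  finally show ?thesis by simp
qed

lemma isqrt_le: "real (isqrt n) \<le> sqrt (real n)"
  unfolding isqrt_def by simp

lemma isqrt_gt: "sqrt (real n) < real (isqrt n) + 1"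
  unfolding isqrt_def by linarith

lemma isqrt_square [simp]: "isqrt (k\<^sup>2) = k"
  unfolding isqrt_def by simp

lemma mono_isqrt: "m \<le> n \<Longrightarrow> isqrt m \<le> isqrt n"
  by (meson le_isqrt_iff le_trans order_refl)

text \<open>As \<open>N < (isqrt N + 1)\<^sup>2\<close>, this is what makes the number of words at
  least double from level to level. In the induction, raising \<open>m\<close> by one at most
  doubles the left side, while the right side gains the factor \<open>Suc m\<close>.\<close>

lemma fact_ge_double_square: "6 \<le> m \<Longrightarrow> 2 * (m + 1)\<^sup>2 \<le> (fact m :: nat)"
proof (induction m rule: nat_induct_at_least)
  case base
  then show ?case by (simp add: fact_numeral)
next
  case (Suc m)
  have "(m + 2)\<^sup>2 \<le> 2 * (m + 1)\<^sup>2"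
    using mult_mono[OF Suc.hyps Suc.hyps] by (simp add: power2_eq_square algebra_simps)
  also have "\<dots> \<le> fact m" by (rule Suc.IH)
  finally have "2 * (m + 2)\<^sup>2 \<le> 2 * fact m" by simp
  also have "\<dots> \<le> Suc m * fact m" using Suc.hyps by (intro mult_right_mono) auto
  finally show ?case by simp
qed

text \<open>This is \<open>fact m \<ge> (m / e) ^ m\<close>; the induction step is
  \<open>(1 + 1 / m) ^ m \<le> e\<close> in logarithmic form.\<close>

lemma ln_fact_ge: "1 \<le> m \<Longrightarrow> real m * (ln (real m) - 1) \<le> ln (fact m)"
proof (induction m rule: nat_induct_at_least)
  case (Suc m)
  have m: "real m > 0" using Suc.hyps by simp
  have "ln (real (Suc m)) - ln (real m) = ln (1 + 1 / real m)"
    using m by (simp add: ln_divide_pos[symmetric] add_divide_distrib add.commute)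
  also have "\<dots> \<le> 1 / real m" using m by (intro ln_add_one_self_le_self) simp
  finally have "real m * (ln (real (Suc m)) - ln (real m)) \<le> 1"
    using m by (simp add: field_simps)
  then have "real (Suc m) * (ln (real (Suc m)) - 1) \<le> real m * (ln (real m) - 1) + ln (real (Suc m))"
    by (simp add: algebra_simps)
  also have "\<dots> \<le> ln (fact m) + ln (real (Suc m))" using Suc.IH by simp
  also have "\<dots> = ln (fact (Suc m))" by (simp add: ln_mult)
  finally show ?case .
qed simp

lemma Nseq_growth:
  assumes "10 \<le> s"
  shows "1024 * 2 ^ j \<le> Nseq (s\<^sup>2) j" and "2 * Nseq (s\<^sup>2) j \<le> Nseq (s\<^sup>2) (Suc j)"
proof -
  have step: "2 * N \<le> fact (isqrt N)" if "1024 \<le> N" for N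
  proof -
    have "6 \<le> isqrt N" using that by (simp add: le_isqrt_iff)
    moreover have "\<not> Suc (isqrt N) \<le> isqrt N" by simp
    then have "N < (isqrt N + 1)\<^sup>2" unfolding le_isqrt_iff by simp
    ultimately show ?thesis using fact_ge_double_square[of "isqrt N"] by linarith
  qed
  have *: "1024 * 2 ^ j \<le> Nseq (s\<^sup>2) j" for j
  proof (induction j)
    case 0
    have "(2::nat) ^ 10 \<le> 2 ^ s" using assms by (intro power_increasing) auto
    then show ?case by simp
  next
    case (Suc j)
    have "(1024::nat) \<le> 1024 * 2 ^ j" by simp
    also note Suc
    finally have "2 * Nseq (s\<^sup>2) j \<le> Nseq (s\<^sup>2) (Suc j)" using step by simp
    then show ?case using Suc by simp
  qed
  show "1024 * 2 ^ j \<le> Nseq (s\<^sup>2) j" by (rule *)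
  have "(1024::nat) \<le> 1024 * 2 ^ j" by simp
  also note *
  finally show "2 * Nseq (s\<^sup>2) j \<le> Nseq (s\<^sup>2) (Suc j)" using step by simp
qed

text \<open>From \<open>fact m \<le> m ^ m\<close> and \<open>m \<le> sqrt N\<close> the new
  logarithm is at most \<open>sqrt N * ln N / 2\<close>, and \<open>sqrt N\<close> is exactly the
  factor by which the square root of the length grows. Hence no constant accumulates over the
  levels.\<close>

lemma ln_Nseq_le:
  assumes "10 \<le> s"
  shows "ln (real (Nseq (s\<^sup>2) j)) \<le> sqrt (real (lseq (s\<^sup>2) j))"
proof (induction j)
  case 0
  have "real s * ln 2 \<le> real s * 1"
    using ln_2_less_1 by (intro mult_left_mono) auto
  then show ?case by (simp add: ln_realpow)
next
  case (Suc j)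
  define N where "N = Nseq (s\<^sup>2) j"
  define m where "m = isqrt N"
  have N: "1024 \<le> N" using Nseq_growth(1)[OF assms, of j] le_trans[of 1024 "1024 * 2 ^ j" N]
    unfolding N_def by simp
  have m: "1 \<le> m" using N unfolding m_def by (simp add: le_isqrt_iff)
  have "ln (fact m) \<le> ln (real m ^ m)"
    using m fact_le_power[of m, where 'a = real] by (subst ln_le_cancel_iff) auto
  also have "\<dots> = real m * ln (real m)" using m by (simp add: ln_realpow)
  also have "\<dots> \<le> sqrt (real N) * ln (sqrt (real N))"
    using m isqrt_le[of N] unfolding m_def[symmetric]
    by (intro mult_mono ln_mono) auto
  also have "\<dots> = sqrt (real N) * (ln (real N) / 2)" using N by (simp add: ln_sqrt)
  also have "\<dots> \<le> sqrt (real N) * sqrt (real (lseq (s\<^sup>2) j))"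
    using order_trans[OF _ Suc, of "ln (real N) / 2"] N unfolding N_def[symmetric] by (intro mult_left_mono) simp_all
  finally show ?case
    unfolding m_def N_def by (simp add: real_sqrt_mult mult.commute)
qed

text \<open>The loss of a constant factor per level comes from \<open>fact m \<ge> (m / e) ^ m\<close>.\<close>
lemma ln_Nseq_ge:
  assumes "10 \<le> s"
  shows "sqrt (real (lseq (s\<^sup>2) j)) / (2 * 8 ^ j) \<le> ln (real (Nseq (s\<^sup>2) j))"
proof (induction j)
  case 0
  have "real s * (1 / 2) \<le> real s * ln 2"
    using ln2_ge_two_thirds by (intro mult_left_mono) auto
  then show ?case by (simp add: ln_realpow)
next
  case (Suc j)
  define N where "N = Nseq (s\<^sup>2) j"
  define m where "m = isqrt N"
  have N: "1024 \<le> N" using Nseq_growth(1)[OF assms, of j] le_trans[of 1024 "1024 * 2 ^ j" N]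
    unfolding N_def by simp
  have m: "1 \<le> m" using N unfolding m_def by (simp add: le_isqrt_iff)
  have sq: "sqrt (real N) / 2 \<le> real m"
    using isqrt_gt[of N] m unfolding m_def by simp
  have "ln (1024::real) = 10 * ln 2" using ln_realpow[of "2::real" 10] by simp
  then have "10 * ln (2::real) \<le> ln (real N)"
    using N ln_le_cancel_iff[of 1024 "real N"] by simp
  moreover have "ln (sqrt (real N) / 2) \<le> ln (real m)"
    using sq N m by (subst ln_le_cancel_iff) (auto intro: divide_pos_pos)
  then have "ln (real N) / 2 - ln 2 \<le> ln (real m)" using N by (simp add: ln_div ln_sqrt)
  \<comment> \<open>The constants are absorbed because \<open>ln N / 4 \<ge> 1 + ln 2\<close>, which
    follows from \<open>ln N \<ge> 10 * ln 2\<close> and \<open>ln 2 \<ge> 2 / 3\<close>.\<close>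
  ultimately have lm: "ln (real N) / 4 \<le> ln (real m) - 1"
    using ln2_ge_two_thirds by linarith
  \<comment> \<open>A factor 2 is lost in \<open>sq\<close> and a factor 4 in \<open>lm\<close>;
    together they give the 8 per level.\<close>
  have "sqrt (real (lseq (s\<^sup>2) (Suc j))) / (2 * 8 ^ Suc j)
      = sqrt (real N) / 2 * ((sqrt (real (lseq (s\<^sup>2) j)) / (2 * 8 ^ j)) / 4)"
    by (simp add: real_sqrt_mult N_def field_simps)
  also have "\<dots> \<le> real m * (ln (real N) / 4)"
    using sq Suc unfolding N_def[symmetric] by (intro mult_mono) auto
  also have "\<dots> \<le> real m * (ln (real m) - 1)" using lm by (intro mult_left_mono) auto
  also have "\<dots> \<le> ln (fact m)" by (rule ln_fact_ge[OF m])
  finally show ?case unfolding m_def N_def by simp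
qed

lemma ln_le_2_sqrt:
  assumes "1 \<le> (y::real)" shows "ln y \<le> 2 * sqrt y"
proof -
  have "ln y = 2 * ln (sqrt y)" using assms by (simp add: ln_sqrt)
  also have "ln (sqrt y) \<le> sqrt y" using assms by (intro ln_bound) simp
  finally show ?thesis by simp
qed

lemma powr_pos: "0 < (y::real) \<Longrightarrow> 0 < y powr a"
  by simp

section \<open>Squares in windows of indices\<close>

lemma Pset_ge: "i \<in> Pset n \<Longrightarrow> 2 \<le> i"
proof -
  have "2 \<le> k\<^sup>2" if "2 \<le> k" for k :: nat
    using mult_le_mono[OF that that] by (simp add: power2_eq_square)
  then show "i \<in> Pset n \<Longrightarrow> 2 \<le> i" unfolding Pset_def by auto
qed

text \<open>If \<open>k\<^sup>2\<close> is the least square in the window, every other one is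
  \<open>(k + d)\<^sup>2 \<ge> k\<^sup>2 + d\<^sup>2\<close>, so \<open>d \<le> isqrt m\<close>. One
  more is added for the index 2, which is not a square.\<close>

lemma card_Pset_window: "card (Pset n \<inter> {a..a + m}) \<le> isqrt m + 2"
proof -
  define A where "A = {i. a \<le> i\<^sup>2 \<and> i\<^sup>2 \<le> a + m}"
  have card_A: "finite A \<and> card A \<le> isqrt m + 1"
  proof (cases "A = {}")
    case False
    define k where "k = (LEAST i. i \<in> A)"
    have k: "k \<in> A" using False LeastI_ex[of "\<lambda>i. i \<in> A"] unfolding k_def by blast
    have "A \<subseteq> {k..k + isqrt m}"
    proof
      fix i assume i: "i \<in> A"
      then have "k \<le> i" unfolding k_def by (rule Least_le)
      then obtain d where d: "i = k + d" using le_Suc_ex by blast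
      have "k\<^sup>2 + d\<^sup>2 \<le> i\<^sup>2" unfolding d power2_sum by simp
      also have "\<dots> \<le> k\<^sup>2 + m" using i k unfolding A_def by simp
      finally show "i \<in> {k..k + isqrt m}" unfolding d by (simp add: le_isqrt_iff)
    qed
    then show ?thesis using card_mono[of "{k..k + isqrt m}" A] finite_subset by auto
  qed simp
  have "Pset n \<inter> {a..a + m} \<subseteq> insert 2 ((\<lambda>i. i\<^sup>2) ` A)"
    unfolding Pset_def A_def by auto
  then have "card (Pset n \<inter> {a..a + m}) \<le> card (insert 2 ((\<lambda>i. i\<^sup>2) ` A))"
    using card_A by (intro card_mono) auto
  also have "\<dots> \<le> Suc (card A)"
    using card_A by (simp add: card_insert_if card_image_le le_SucI)
  finally show ?thesis using card_A by linarith
qed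

text \<open>Cutting at the multiples of \<open>n\<close> leaves at most three pieces, each an
  ordinary window. The \<open>Suc\<close> appears because blocks are counted from 0 and words from
  1.\<close>

lemma card_Pset_periodic_window:
  assumes "a < n" "m \<le> n"
  shows "card {e \<in> {a..a + m}. Suc (e mod n) \<in> Pset n} \<le> 3 * (isqrt m + 2)"
proof -
  define Q where "Q b = {e \<in> {a..a + m}. e div n = b \<and> Suc (e mod n) \<in> Pset n}" for b
  have Q: "card (Q b) \<le> isqrt m + 2" for b
  proof -
    have e: "e = b * n + e mod n" if "e \<in> Q b" for e
      using that unfolding Q_def by auto
    have "inj_on (\<lambda>e. Suc (e mod n)) (Q b)"
      by (intro inj_onI) (metis e nat.inject)
    \<comment> \<open>The truncated difference \<open>a - b * n\<close> is 0 for a piece that begins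
      at a multiple of \<open>n\<close> beyond \<open>a\<close>, so both kinds of pieces are
      covered.\<close>
    moreover have "(\<lambda>e. Suc (e mod n)) ` Q b \<subseteq> Pset n \<inter> {Suc (a - b * n)..Suc (a - b * n) + m}"
    proof
      fix y assume "y \<in> (\<lambda>e. Suc (e mod n)) ` Q b"
      then obtain e' where e': "e' \<in> Q b" "y = Suc (e' mod n)" by blast
      then have "y \<in> Pset n" "a \<le> e'" "e' \<le> a + m" unfolding Q_def by auto
      then show "y \<in> Pset n \<inter> {Suc (a - b * n)..Suc (a - b * n) + m}"
        using e[OF e'(1)] e'(2) by auto
    qed
    ultimately have "card (Q b) \<le> card (Pset n \<inter> {Suc (a - b * n)..Suc (a - b * n) + m})"
      by (intro card_inj_on_le) auto
    also have "\<dots> \<le> isqrt m + 2" by (rule card_Pset_window)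
    finally show ?thesis .
  qed
  have "{e \<in> {a..a + m}. Suc (e mod n) \<in> Pset n} \<subseteq> (\<Union>b<3. Q b)"
  proof
    fix e assume e: "e \<in> {e \<in> {a..a + m}. Suc (e mod n) \<in> Pset n}"
    then have "e < 3 * n" using assms by auto
    then have "e div n < 3" using assms by (intro less_mult_imp_div_less)
    with e show "e \<in> (\<Union>b<3. Q b)" unfolding Q_def by auto
  qed
  then have "card {e \<in> {a..a + m}. Suc (e mod n) \<in> Pset n} \<le> card (\<Union>b<3. Q b)"
    by (intro card_mono) (auto simp: Q_def)
  also have "\<dots> \<le> (\<Sum>b<3. card (Q b))" by (intro card_UN_le) simp
  also have "\<dots> \<le> (\<Sum>b<(3::nat). isqrt m + 2)" using Q by (intro sum_mono)
  finally show ?thesis by simp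
qed

subsection \<open>Concatenations of words and recognizability\<close>

locale marker =
  fixes l1 :: nat and u :: "nat \<Rightarrow> nat \<Rightarrow> bool list"
  assumes l1_ge: "100 \<le> l1" and marker: "marker_construction l1 u"
begin

abbreviation "N \<equiv> Nseq l1"
abbreviation "l \<equiv> lseq l1"

lemma l1_square: obtains s where "l1 = s\<^sup>2" "10 \<le> s"
proof -
  obtain s where s: "l1 = s\<^sup>2" using marker unfolding marker_construction_def by blast
  moreover have "10 \<le> s"
  proof (rule ccontr)
    assume "\<not> 10 \<le> s"
    then have "s\<^sup>2 \<le> 9\<^sup>2" by (intro power_mono) auto
    then show False using s l1_ge by simp
  qed
  ultimately show ?thesis by (rule that)
qed

lemma N_ge: "1024 * 2 ^ j \<le> N j" and N_double: "2 * N j \<le> N (Suc j)"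
proof -
  obtain s where "l1 = s\<^sup>2" "10 \<le> s" by (rule l1_square)
  then show "1024 * 2 ^ j \<le> N j" "2 * N j \<le> N (Suc j)" using Nseq_growth by blast+
qed

lemma ln_N_le: "ln (real (N j)) \<le> sqrt (real (l j))"
  and ln_N_ge: "sqrt (real (l j)) / (2 * 8 ^ j) \<le> ln (real (N j))"
proof -
  obtain s where "l1 = s\<^sup>2" "10 \<le> s" by (rule l1_square)
  then show "ln (real (N j)) \<le> sqrt (real (l j))"
    "sqrt (real (l j)) / (2 * 8 ^ j) \<le> ln (real (N j))"
    using ln_Nseq_le ln_Nseq_ge by blast+
qed

lemma N_ge_1024: "1024 \<le> N j"
  using N_ge[of j] by (rule order_trans[rotated]) simp

lemma N_pos [simp]: "0 < N j" "N j \<noteq> 0"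
  using N_ge_1024[of j] by auto

lemma l_pos [simp]: "0 < l j" "l j \<noteq> 0"
proof -
  show "0 < l j" using l1_ge by (induction j) auto
  then show "l j \<noteq> 0" by simp
qed

lemma l_double: "2 * l j \<le> l (Suc j)"
  using N_ge_1024[of j] by (simp add: mult.commute)

lemma l_strict_mono: "strict_mono l"
  unfolding strict_mono_Suc_iff
proof
  show "l n < l (Suc n)" for n using l_double[of n] l_pos(1)[of n] by linarith
qed

lemma bij_next:
  "bij_betw (u (Suc j)) {1..N (Suc j)} (next_words (u j) (N j))"
  using marker unfolding marker_construction_def by blast

lemma inj_u: "inj_on (u j) {1..N j}"
proof (cases j)
  case 0
  then show ?thesis using marker unfolding marker_construction_def by blast
next
  case (Suc k)
  then show ?thesis using bij_next[of k] by (simp add: bij_betw_def)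
qed

text \<open>The length of the words of level \<open>j\<close> is a hypothesis because
  \<open>length_u\<close> is derived from this lemma by induction.\<close>

lemma u_Suc:
  assumes "a \<in> {1..N (Suc j)}" and len: "\<And>i. i \<in> {1..N j} \<Longrightarrow> length (u j i) = l j"
  shows "length (u (Suc j) a) = l (Suc j) \<and>
    (\<exists>\<pi>. \<pi> permutes {1..N j} \<and> (\<forall>i. i \<notin> Pset (N j) \<longrightarrow> \<pi> i = i) \<and>
      (\<forall>i t. i < N j \<longrightarrow> t < l j \<longrightarrow> u (Suc j) a ! (i * l j + t) = u j (\<pi> (Suc i)) ! t))"
proof -
  have "u (Suc j) a \<in> next_words (u j) (N j)"
    using bij_next[of j] assms(1) by (auto simp: bij_betw_def)
  then obtain \<pi> where ua: "u (Suc j) a = concat (map (u j \<circ> \<pi>) [1..<N j + 1])"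
    and \<pi>: "\<pi> permutes {1..N j}" and fixed: "\<forall>i\<in>{1..N j}. i \<notin> Pset (N j) \<longrightarrow> \<pi> i = i"
    unfolding next_words_def by auto
  have len': "length (u j (\<pi> i)) = l j" if "i \<in> {1..N j}" for i
    using len permutes_in_image[OF \<pi>] that by blast
  define C where "C m = concat (map (u j \<circ> \<pi>) [1..<m + 1])" for m
  have C_Suc: "C (Suc m) = C m @ u j (\<pi> (Suc m))" for m
    unfolding C_def by simp
  have "m \<le> N j \<Longrightarrow> length (C m) = m * l j \<and>
    (\<forall>i t. i < m \<longrightarrow> t < l j \<longrightarrow> C m ! (i * l j + t) = u j (\<pi> (Suc i)) ! t)" for m
  proof (induction m)
    case 0
    then show ?case by (simp add: C_def)
  next
    case (Suc m)
    then have IH: "length (C m) = m * l j"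
      "\<And>i t. i < m \<Longrightarrow> t < l j \<Longrightarrow> C m ! (i * l j + t) = u j (\<pi> (Suc i)) ! t"
      by auto
    have less: "i * l j + t < m * l j" if "i < m" "t < l j" for i t
    proof -
      have "i * l j + t < Suc i * l j" using that by simp
      also have "\<dots> \<le> m * l j" using that by (intro mult_le_mono1) simp
      finally show ?thesis .
    qed
    show ?case
      using IH len'[of "Suc m"] Suc.prems less
      by (auto simp: C_Suc nth_append less_Suc_eq)
  qed
  from this[of "N j", OF le_refl] have "length (u (Suc j) a) = l (Suc j)"
    "\<forall>i t. i < N j \<longrightarrow> t < l j \<longrightarrow> u (Suc j) a ! (i * l j + t) = u j (\<pi> (Suc i)) ! t"
    unfolding C_def ua by (auto simp only: mult.commute lseq.simps)
  moreover have "\<pi> i = i" if "i \<notin> Pset (N j)" for i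
    using that fixed permutes_not_in[OF \<pi>] by blast
  ultimately show ?thesis using \<pi> by blast
qed

lemma length_u: "i \<in> {1..N j} \<Longrightarrow> length (u j i) = l j"
proof (induction j arbitrary: i)
  case 0
  then show ?case using marker unfolding marker_construction_def by simp
next
  case (Suc j)
  then show ?case using u_Suc by blast
qed

lemma u_eqI:
  assumes "a \<in> {1..N j}" "b \<in> {1..N j}" "\<And>t. t < l j \<Longrightarrow> u j a ! t = u j b ! t"
  shows "a = b"
proof -
  have "u j a = u j b"
    using assms by (intro nth_equalityI) (simp_all add: length_u)
  then show ?thesis using inj_onD[OF inj_u] assms(1,2) by blast
qed

text \<open>Windows of points of the subshift are compared with one-sided infinite concatenations \<open>W\<close> of words,
  which avoids any bookkeeping of the ends of the window.\<close>
definition tiled :: "nat \<Rightarrow> (nat \<Rightarrow> bool) \<Rightarrow> bool" where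
  "tiled j W \<longleftrightarrow> (\<exists>v. \<forall>b. v b \<in> {1..N j} \<and> (\<forall>t<l j. W (b * l j + t) = u j (v b) ! t))"

lemma tiled_perms:
  assumes "tiled (Suc j) W"
  obtains \<rho> where "\<And>b. \<rho> b permutes {1..N j}" "\<And>b i. i \<notin> Pset (N j) \<Longrightarrow> \<rho> b i = i"
    "\<And>b i t. i < N j \<Longrightarrow> t < l j \<Longrightarrow> W (b * l (Suc j) + i * l j + t) = u j (\<rho> b (Suc i)) ! t"
proof -
  obtain v where v: "\<And>b. v b \<in> {1..N (Suc j)}"
      "\<And>b t. t < l (Suc j) \<Longrightarrow> W (b * l (Suc j) + t) = u (Suc j) (v b) ! t"
    using assms unfolding tiled_def by blast
  have "\<forall>b. \<exists>\<pi>. \<pi> permutes {1..N j} \<and> (\<forall>i. i \<notin> Pset (N j) \<longrightarrow> \<pi> i = i) \<and>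
      (\<forall>i t. i < N j \<longrightarrow> t < l j \<longrightarrow> u (Suc j) (v b) ! (i * l j + t) = u j (\<pi> (Suc i)) ! t)"
    using u_Suc[OF v(1) length_u] by blast
  then obtain \<rho> where \<rho>: "\<And>b. \<rho> b permutes {1..N j}" "\<And>b i. i \<notin> Pset (N j) \<Longrightarrow> \<rho> b i = i"
      "\<And>b i t. i < N j \<Longrightarrow> t < l j \<Longrightarrow> u (Suc j) (v b) ! (i * l j + t) = u j (\<rho> b (Suc i)) ! t"
    by metis
  have "W (b * l (Suc j) + i * l j + t) = u j (\<rho> b (Suc i)) ! t" if "i < N j" "t < l j" for b i t
  proof -
    have "i * l j + t < Suc i * l j" using that by simp
    also have "\<dots> \<le> N j * l j" using that by (intro mult_le_mono1) simp
    finally have "i * l j + t < l (Suc j)" by (simp add: mult.commute)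
    then show ?thesis using v(2)[of "i * l j + t" b] \<rho>(3)[OF that] by (simp add: add.assoc)
  qed
  then show ?thesis using that \<rho> by blast
qed

lemma tiled_perms_blocks:
  assumes "\<And>b i t. i < N j \<Longrightarrow> t < l j \<Longrightarrow> W (b * l (Suc j) + i * l j + t) = u j (\<rho> b (Suc i)) ! t"
  shows "t < l j \<Longrightarrow> W (e * l j + t) = u j (\<rho> (e div N j) (Suc (e mod N j))) ! t"
proof -
  assume t: "t < l j"
  have "e div N j * l (Suc j) + e mod N j * l j = (e div N j * N j + e mod N j) * l j"
    by (simp only: lseq.simps algebra_simps)
  also have "\<dots> = e * l j" unfolding div_mult_mod_eq ..
  finally show ?thesis
    using assms[of "e mod N j" t "e div N j"] t by (simp del: lseq.simps)
qed

lemma tiled_down: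
  assumes "tiled (Suc j) W" shows "tiled j W"
proof -
  obtain \<rho> where \<rho>: "\<And>b. \<rho> b permutes {1..N j}"
    "\<And>b i t. i < N j \<Longrightarrow> t < l j \<Longrightarrow> W (b * l (Suc j) + i * l j + t) = u j (\<rho> b (Suc i)) ! t"
    using tiled_perms[OF assms] by metis
  have "\<rho> b (Suc i) \<in> {1..N j}" if "i < N j" for b i
    using permutes_in_image[OF \<rho>(1), of b "Suc i"] that by auto
  then show ?thesis
    unfolding tiled_def using tiled_perms_blocks[OF \<rho>(2)]
    by (intro exI[of _ "\<lambda>e. \<rho> (e div N j) (Suc (e mod N j))"]) auto
qed

lemma tiled_le: "j \<le> k \<Longrightarrow> tiled k W \<Longrightarrow> tiled j W"
  by (induction rule: dec_induct) (auto dest: tiled_down)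

lemma tiled_drop:
  assumes "tiled j W" shows "tiled j (\<lambda>t. W (d * l j + t))"
proof -
  obtain v where v: "\<And>b. v b \<in> {1..N j}" "\<And>b t. t < l j \<Longrightarrow> W (b * l j + t) = u j (v b) ! t"
    using assms unfolding tiled_def by blast
  have "W (d * l j + (b * l j + t)) = u j (v (d + b)) ! t" if "t < l j" for b t
    using v(2)[OF that, of "d + b"] by (simp add: algebra_simps)
  then show ?thesis
    unfolding tiled_def using v(1) by (intro exI[of _ "\<lambda>b. v (d + b)"]) blast
qed

text \<open>At level 0 the prefix 001 marks the beginning of a word. At level \<open>Suc j\<close> the marker is the first
  word of level \<open>j\<close>: since \<open>1 \<notin> Pset (N j)\<close>, it occurs in each word exactly at the beginning.\<close>
lemma recognizable:
  assumes "tiled j W" "i \<in> {1..N j}" "\<And>t. t < l j \<Longrightarrow> W (q + t) = u j i ! t"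
  shows "l j dvd q"
  using assms
proof (induction j arbitrary: i)
  case 0
  have u0: "length (u 0 i) = l1" "u 0 i ! 0 = False" "u 0 i ! 1 = False" "u 0 i ! 2 = True"
    "\<And>k. Suc k < l1 \<Longrightarrow> u 0 i ! k = False \<Longrightarrow> u 0 i ! Suc k = False \<Longrightarrow> k = 0"
    if "i \<in> {1..N 0}" for i
  proof -
    have i: "length (u 0 i) = l1 \<and> take 3 (u 0 i) = [False, False, True] \<and> zz_only_prefix (u 0 i)"
      using marker that unfolding marker_construction_def by blast
    then show "length (u 0 i) = l1"
      and "\<And>k. Suc k < l1 \<Longrightarrow> u 0 i ! k = False \<Longrightarrow> u 0 i ! Suc k = False \<Longrightarrow> k = 0"
      unfolding zz_only_prefix_def by auto
    have "u 0 i ! k = take 3 (u 0 i) ! k" if "k < 3" for k using that by simp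
    from this[of 0] this[of 1] this[of 2]
    show "u 0 i ! 0 = False" "u 0 i ! 1 = False" "u 0 i ! 2 = True" using i by auto
  qed
  obtain v where v: "\<And>b. v b \<in> {1..N 0}" "\<And>b t. t < l1 \<Longrightarrow> W (b * l1 + t) = u 0 (v b) ! t"
    using 0(1) unfolding tiled_def by auto
  define b where "b = q div l1"
  define r where "r = q mod l1"
  have q: "q = b * l1 + r" and r: "r < l1" using l1_ge by (auto simp: b_def r_def)
  have W: "W q = False" "W (Suc q) = False" "W (Suc (Suc q)) = True"
    using 0(3)[of 0] 0(3)[of 1] 0(3)[of 2] u0(2-4)[OF 0(2)] l1_ge by auto
  have "r = 0"
  proof (cases "Suc r < l1")
    case True
    then show ?thesis using u0(5)[OF v(1)[of b] True] v(2)[of r b] v(2)[of "Suc r" b] W q by auto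
  next
    \<comment> \<open>Here the two zeros would straddle a boundary, so the 1 following them would be
      the second letter of the next word, which is 0.\<close>
    case False
    then have "Suc q = Suc b * l1" using q r by simp
    then have "W (Suc (Suc q)) = u 0 (v (Suc b)) ! 1"
      using v(2)[of 1 "Suc b"] l1_ge by simp
    then show ?thesis using u0(3)[OF v(1)] W by simp
  qed
  then show ?case using q by simp
next
  case (Suc j)
  have one: "1 \<in> {1..N j}" using N_ge_1024[of j] by simp
  have fix1: "\<pi> 1 = 1" if "\<forall>i. i \<notin> Pset (N j) \<longrightarrow> \<pi> i = i" for \<pi>
    using that Pset_ge[of 1 "N j"] by auto
  obtain \<pi> where \<pi>: "\<forall>i. i \<notin> Pset (N j) \<longrightarrow> \<pi> i = i"
    "\<forall>i' t. i' < N j \<longrightarrow> t < l j \<longrightarrow> u (Suc j) i ! (i' * l j + t) = u j (\<pi> (Suc i')) ! t"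
    using u_Suc[OF Suc.prems(2) length_u] by blast
  have Wq: "W (q + t) = u j 1 ! t" if "t < l j" for t
    using Suc.prems(3)[of t] order_less_le_trans[OF that, of "l (Suc j)"] \<pi>(2)[rule_format, of 0 t] fix1[OF \<pi>(1)] that N_pos(1)[of j] l_double[of j]
    by auto
  then have "l j dvd q" using Suc.IH[OF tiled_down[OF Suc.prems(1)] one] by blast
  then obtain e where e: "q = e * l j" unfolding dvd_def by (auto simp: mult.commute)
  obtain \<rho> where \<rho>: "\<And>b. \<rho> b permutes {1..N j}" "\<And>b i. i \<notin> Pset (N j) \<Longrightarrow> \<rho> b i = i"
    "\<And>b i t. i < N j \<Longrightarrow> t < l j \<Longrightarrow> W (b * l (Suc j) + i * l j + t) = u j (\<rho> b (Suc i)) ! t"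
    using tiled_perms[OF Suc.prems(1)] by metis
  have em: "Suc (e mod N j) \<in> {1..N j}" by (simp add: Suc_leI)
  \<comment> \<open>Distinct words have distinct indices, so this block carries index 1; each
    permutation is injective and fixes 1, so the block is the first of its surrounding
    block.\<close>
  have "\<rho> (e div N j) (Suc (e mod N j)) = 1"
  proof (rule u_eqI[OF _ one])
    show "\<rho> (e div N j) (Suc (e mod N j)) \<in> {1..N j}" using permutes_in_image[OF \<rho>(1)] em by blast
    show "u j (\<rho> (e div N j) (Suc (e mod N j))) ! t = u j 1 ! t" if "t < l j" for t
      using tiled_perms_blocks[OF \<rho>(3) that, of e] Wq[OF that] unfolding e by simp
  qed
  moreover have "\<rho> (e div N j) 1 = 1" using fix1 \<rho>(2) by blast
  ultimately have "e mod N j = 0"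
    using injD[OF permutes_inj[OF \<rho>(1), of "e div N j"], of "Suc (e mod N j)" 1] by simp
  then show ?case unfolding e by (simp add: mult.commute mod_eq_0_iff_dvd)
qed

text \<open>A finite window lies in some word \<open>u k i\<close>. Repeating that word periodically
  gives an infinite tiling, and discarding whole blocks of level \<open>j\<close> brings the offset
  below \<open>l j\<close>.\<close>

lemma subshift_window:
  assumes "x \<in> marker_subshift l1 u"
  obtains W c where "c < l j" "tiled j W" "\<And>t. t < n \<Longrightarrow> x (int t) = W (c + t)"
proof -
  \<comment> \<open>The surplus \<open>l j\<close> excludes words of level below \<open>j\<close>,
    in which the window would not fit.\<close>
  define m where "m = n + l j"
  have "map (\<lambda>k. x (0 + int k)) [0..<m] \<in> marker_language l1 u"
    using assms unfolding marker_subshift_def by blast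
  then obtain k i where i: "i \<in> {1..N k}" and sub: "sublist (map (\<lambda>k. x (int k)) [0..<m]) (u k i)"
    unfolding marker_language_def by auto
  then obtain p s where ps: "u k i = p @ map (\<lambda>k. x (int k)) [0..<m] @ s"
    unfolding sublist_def by blast
  have "l j \<le> length (u k i)" using ps by (simp add: m_def)
  then have "j \<le> k" using length_u[OF i] l_strict_mono by (simp add: strict_mono_less_eq)
  moreover have "tiled k (\<lambda>t. u k i ! (t mod l k))"
    unfolding tiled_def using i by (intro exI[of _ "\<lambda>_. i"]) auto
  ultimately have "tiled j (\<lambda>t. u k i ! (t mod l k))" by (rule tiled_le)
  from tiled_drop[OF this, of "length p div l j"]
  have T: "tiled j (\<lambda>t. u k i ! ((length p div l j * l j + t) mod l k))" .
  have "x (int t) = u k i ! ((length p div l j * l j + (length p mod l j + t)) mod l k)" if "t < n" for t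
  proof -
    have "length p + t < length (u k i)" using that by (simp add: ps m_def)
    then have "(length p + t) mod l k = length p + t" using length_u[OF i] by simp
    moreover have "length p div l j * l j + (length p mod l j + t) = length p + t"
      by (simp only: add.assoc[symmetric] div_mult_mod_eq)
    ultimately have "u k i ! ((length p div l j * l j + (length p mod l j + t)) mod l k)
      = u k i ! (length p + t)" by presburger
    then show ?thesis using that by (simp add: ps nth_append m_def)
  qed
  with T show ?thesis by (intro that[of "length p mod l j"]) auto
qed

subsection \<open>Number of words of given length\<close>

definition words :: "nat \<Rightarrow> bool list set" where
  "words n = (\<lambda>x. map (\<lambda>i. x (int i)) [0..<n]) ` marker_subshift l1 u"

text \<open>A word of length \<open>n < l (Suc j)\<close> is determined by its offset in a block of level \<open>Suc j\<close> and
  by the values of the permutations at the elements of \<open>Pset (N j)\<close> that it meets.\<close>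
lemma card_words_le:
  assumes n: "n < l (Suc j)"
  shows "finite (words n)"
    and "card (words n) \<le> l (Suc j) * N j ^ (3 * (isqrt (Suc (n div l j)) + 2))"
proof -
  define Q where "Q c = {e \<in> {c div l j..c div l j + Suc (n div l j)}. Suc (e mod N j) \<in> Pset (N j)}" for c
  define F where "F c f = map (\<lambda>i. u j (let e = (c + i) div l j in if e \<in> Q c then f e else Suc (e mod N j))
    ! ((c + i) mod l j)) [0..<n]" for c and f :: "nat \<Rightarrow> nat"
  define S where "S = (\<Union>c<l (Suc j). F c ` (Q c \<rightarrow>\<^sub>E {1..N j}))"
  have nl: "n div l j < N j" using n by (intro less_mult_imp_div_less) (simp add: mult.commute)
  have "w \<in> S" if "w \<in> words n" for w
  proof -
    obtain x where x: "x \<in> marker_subshift l1 u" and w: "w = map (\<lambda>i. x (int i)) [0..<n]"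
      using \<open>w \<in> words n\<close> unfolding words_def by blast
    obtain W c where c: "c < l (Suc j)" and W: "tiled (Suc j) W" and xW: "\<And>t. t < n \<Longrightarrow> x (int t) = W (c + t)"
      using subshift_window[OF x] by metis
    obtain \<rho> where \<rho>: "\<And>b. \<rho> b permutes {1..N j}" "\<And>b i. i \<notin> Pset (N j) \<Longrightarrow> \<rho> b i = i"
      "\<And>b i t. i < N j \<Longrightarrow> t < l j \<Longrightarrow> W (b * l (Suc j) + i * l j + t) = u j (\<rho> b (Suc i)) ! t"
      using tiled_perms[OF W] by metis
    define f where "f = restrict (\<lambda>e. \<rho> (e div N j) (Suc (e mod N j))) (Q c)"
    have "Suc (e mod N j) \<in> {1..N j}" for e by (simp add: Suc_leI)
    then have "f \<in> Q c \<rightarrow>\<^sub>E {1..N j}"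
      unfolding f_def using permutes_in_image[OF \<rho>(1)] by auto
    moreover have "w = F c f"
      unfolding w F_def
    proof (intro map_cong refl)
      fix i assume "i \<in> set [0..<n]"
      then have i: "i < n" by simp
      define e where "e = (c + i) div l j"
      have ci: "c + i = e * l j + (c + i) mod l j" unfolding e_def by (rule div_mult_mod_eq[symmetric])
      have "c < Suc (c div l j) * l j" "n < Suc (n div l j) * l j"
        using dividend_less_div_times[of "l j" c] dividend_less_div_times[of "l j" n] by simp_all
      then have "c + i < (c div l j + n div l j + 2) * l j" using i by (simp add: algebra_simps)
      then have "e < c div l j + n div l j + 2" unfolding e_def by (rule less_mult_imp_div_less)
      then have e: "e \<in> {c div l j..c div l j + Suc (n div l j)}"
        unfolding e_def by (auto intro: div_le_mono)
      have "x (int i) = W (e * l j + (c + i) mod l j)" using xW[OF i] ci by simp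
      also have "\<dots> = u j (\<rho> (e div N j) (Suc (e mod N j))) ! ((c + i) mod l j)"
        by (rule tiled_perms_blocks[OF \<rho>(3)]) simp_all
      also have "\<rho> (e div N j) (Suc (e mod N j)) = (if e \<in> Q c then f e else Suc (e mod N j))"
        using e \<rho>(2) unfolding f_def Q_def by auto
      finally show "x (int i) = u j (let e = (c + i) div l j in if e \<in> Q c then f e else Suc (e mod N j)) ! ((c + i) mod l j)"
        by (simp add: e_def Let_def)
    qed
    ultimately show "w \<in> S" unfolding S_def using c by blast
  qed
  then have sub: "words n \<subseteq> S" by blast
  have finQ: "finite (Q c)" for c unfolding Q_def by simp
  then have fin: "finite (Q c \<rightarrow>\<^sub>E {1..N j})" for c by (intro finite_PiE) auto
  then have finS: "finite S" unfolding S_def by auto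
  show "finite (words n)" using sub finS by (rule finite_subset)
  have "card (words n) \<le> card S" using sub finS by (rule card_mono[rotated])
  also have "\<dots> \<le> (\<Sum>c<l (Suc j). card (F c ` (Q c \<rightarrow>\<^sub>E {1..N j})))"
    unfolding S_def by (rule card_UN_le) simp
  also have "\<dots> \<le> (\<Sum>c<l (Suc j). N j ^ (3 * (isqrt (Suc (n div l j)) + 2)))"
  proof (intro sum_mono)
    fix c assume "c \<in> {..<l (Suc j)}"
    then have c: "c div l j < N j" by (intro less_mult_imp_div_less) (simp add: mult.commute)
    have "card (F c ` (Q c \<rightarrow>\<^sub>E {1..N j})) \<le> card (Q c \<rightarrow>\<^sub>E {1..N j})" by (rule card_image_le[OF fin])
    also have "\<dots> = N j ^ card (Q c)" using finQ by (simp add: card_PiE)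
    also have "\<dots> \<le> N j ^ (3 * (isqrt (Suc (n div l j)) + 2))"
      using card_Pset_periodic_window[OF c, of "Suc (n div l j)"] nl N_ge_1024[of j]
      unfolding Q_def by (intro power_increasing) auto
    finally show "card (F c ` (Q c \<rightarrow>\<^sub>E {1..N j})) \<le> N j ^ (3 * (isqrt (Suc (n div l j)) + 2))" .
  qed
  finally show "card (words n) \<le> l (Suc j) * N j ^ (3 * (isqrt (Suc (n div l j)) + 2))" by simp
qed

lemma level_exists:
  assumes "l1 \<le> n" obtains j where "l j \<le> n" "n < l (Suc j)"
proof -
  have "\<exists>j. n < l j"
    using strict_mono_imp_increasing[OF l_strict_mono, of "Suc n"] by (metis Suc_le_lessD)
  define k where "k = (LEAST j. n < l j)"
  have k: "n < l k" unfolding k_def by (rule LeastI_ex) fact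
  then have "k \<noteq> 0" using assms by (cases k) auto
  then obtain j where j: "k = Suc j" by (cases k) auto
  have "\<not> n < l j" using not_less_Least[of j "\<lambda>j. n < l j"] j unfolding k_def by simp
  then show ?thesis using that[of j] k j by simp
qed

text \<open>At the level with \<open>l j \<le> n < l (Suc j)\<close> one has
  \<open>m * l j \<le> 2 * n\<close>, so \<open>isqrt m * ln (N j)\<close> is at most
  \<open>1.5 * sqrt n\<close>. In multiples of \<open>sqrt n\<close>, the offset contributes
  \<open>2 + 1\<close> and the exponent \<open>3 * (isqrt m + 2)\<close> contributes
  \<open>4.5 + 6\<close>, in total less than 15.\<close>

lemma card_words_exp:
  assumes "l1 \<le> n"
  shows "finite (words n)" "real (card (words n)) \<le> exp (15 * sqrt (real n))"
proof -
  obtain j where j: "l j \<le> n" "n < l (Suc j)" using level_exists[OF assms] by metis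
  define m where "m = Suc (n div l j)"
  show "finite (words n)" using card_words_le(1)[OF j(2)] .
  have lj: "real (l j) \<ge> 1" using l_pos(1)[of j] by linarith
  have nj: "real (l j) \<le> real n" using j by simp
  then have sn: "sqrt (real (l j)) \<le> sqrt (real n)" by simp
  have "real m * real (l j) \<le> 2 * real n"
  proof -
    have "n div l j * l j \<le> n" by simp
    then have "m * l j \<le> 2 * n" using j unfolding m_def mult_Suc by linarith
    then show ?thesis by (metis of_nat_le_iff of_nat_mult of_nat_numeral)
  qed
  then have "sqrt (real m) * sqrt (real (l j)) \<le> sqrt 2 * sqrt (real n)"
    by (metis real_sqrt_le_iff real_sqrt_mult)
  moreover have "sqrt 2 * sqrt (real n) \<le> 1.5 * sqrt (real n)"
    by (intro mult_right_mono real_le_lsqrt) (auto simp: power2_eq_square)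
  moreover have "real (isqrt m) * sqrt (real (l j)) \<le> sqrt (real m) * sqrt (real (l j))"
    using isqrt_le[of m] by (intro mult_right_mono) auto
  ultimately have m: "real (isqrt m) * sqrt (real (l j)) \<le> 1.5 * sqrt (real n)" by linarith
  have "ln (real (l j)) = 2 * ln (sqrt (real (l j)))" using lj by (simp add: ln_sqrt)
  also have "\<dots> \<le> 2 * sqrt (real (l j))"
    using ln_bound[of "sqrt (real (l j))"] lj by simp
  finally have lnl: "ln (real (l j)) \<le> 2 * sqrt (real n)" using sn by linarith
  have lnN: "ln (real (N j)) \<le> sqrt (real n)" using ln_N_le[of j] sn by linarith
  have "real (card (words n)) \<le> real (l j * N j * N j ^ (3 * (isqrt m + 2)))"
    using card_words_le(2)[OF j(2)] unfolding m_def lseq.simps of_nat_le_iff .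
  also have "\<dots> = exp (ln (real (l j)) + ln (real (N j)) + real (3 * (isqrt m + 2)) * ln (real (N j)))"
    unfolding exp_add exp_of_nat_mult by simp
  also have "\<dots> \<le> exp (15 * sqrt (real n))"
  proof -
    have "real (isqrt m) * ln (real (N j)) \<le> real (isqrt m) * sqrt (real (l j))"
      using ln_N_le[of j] by (intro mult_left_mono) auto
    then have "real (3 * (isqrt m + 2)) * ln (real (N j)) \<le> 4.5 * sqrt (real n) + 6 * sqrt (real n)"
      using m lnN by (simp add: algebra_simps)
    then show ?thesis using lnl lnN real_sqrt_ge_zero[of "real n"]
      unfolding exp_le_cancel_iff by linarith
  qed
  finally show "real (card (words n)) \<le> exp (15 * sqrt (real n))" .
qed

subsection \<open>Return times along fixed blocks\<close>

text \<open>Any power of \<open>N j\<close> with exponent strictly between 0 and 1/2 would do: then bad blocks have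
  summable density, while \<open>g j\<close> outgrows every power of \<open>l j\<close>.\<close>
definition g where "g j = isqrt (isqrt (N j))"

text \<open>Indices (from 0) of blocks of level \<open>j\<close> that are followed within \<open>g j\<close> blocks by a block
  that may be permuted or by the end of the surrounding block of level \<open>Suc j\<close>.\<close>
definition bad_blocks :: "nat \<Rightarrow> nat set" where
  "bad_blocks j = {i. i < N j \<and> (\<exists>d\<le>g j. N j < Suc (i + d) \<or> Suc (i + d) \<in> Pset (N j))}"

lemma g_bounds: "2 \<le> g j" "g j \<le> N j"
proof -
  show "2 \<le> g j" using N_ge_1024[of j] by (simp add: g_def le_isqrt_iff)
  have le: "isqrt n \<le> n" for n
  proof -
    have "isqrt n * 1 \<le> (isqrt n)\<^sup>2" unfolding power2_eq_square by (cases "isqrt n") simp_all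
    moreover have "(isqrt n)\<^sup>2 \<le> n" by (rule le_isqrt_iff[THEN iffD1, OF le_refl])
    ultimately show ?thesis by linarith
  qed
  show "g j \<le> N j" unfolding g_def by (rule le_trans[OF le le])
qed

text \<open>A bad index precedes, by a bounded distance, a permutable index or the end of the
  surrounding block, represented by \<open>Suc (N j)\<close>. The bound is of order
  \<open>N j powr (3/4)\<close>, a vanishing proportion of \<open>N j\<close>.\<close>

lemma card_bad_blocks: "card (bad_blocks j) \<le> (isqrt (N j) + 3) * (g j + 1)"
proof -
  define P where "P = insert (Suc (N j)) (Pset (N j) \<inter> {0..0 + N j})"
  have "bad_blocks j \<subseteq> (\<lambda>(p, d). p - Suc d) ` (P \<times> {..g j})"
  proof
    fix i assume "i \<in> bad_blocks j"
    then have i: "i < N j" and ex: "\<exists>d. d \<le> g j \<and> (N j < Suc (i + d) \<or> Suc (i + d) \<in> Pset (N j))"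
      unfolding bad_blocks_def by auto
    show "i \<in> (\<lambda>(p, d). p - Suc d) ` (P \<times> {..g j})"
    proof (cases "\<exists>d\<le>g j. N j < Suc (i + d)")
      case True
      then have "N j - i \<le> g j" using i by auto
      then show ?thesis using i unfolding P_def by (intro image_eqI[of _ _ "(Suc (N j), N j - i)"]) auto
    next
      case False
      then obtain d where "d \<le> g j" "Suc (i + d) \<in> P" using ex unfolding P_def by (auto simp: not_less)
      then show ?thesis by (intro image_eqI[of _ _ "(Suc (i + d), d)"]) auto
    qed
  qed
  moreover have fin: "finite (P \<times> {..g j})" unfolding P_def by simp
  ultimately have "card (bad_blocks j) \<le> card ((\<lambda>(p, d). p - Suc d) ` (P \<times> {..g j}))"
    by (intro card_mono) auto
  also have "\<dots> \<le> card (P \<times> {..g j})" by (rule card_image_le[OF fin])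
  also have "\<dots> = card P * (g j + 1)" by (simp add: card_cartesian_product)
  also have "\<dots> \<le> (isqrt (N j) + 3) * (g j + 1)"
    using card_Pset_window[of "N j" 0 "N j"] unfolding P_def
    by (intro mult_le_mono1) (simp add: card_insert_if)
  finally show ?thesis .
qed

text \<open>With \<open>e = q div l j\<close>, the blocks \<open>e\<close> to \<open>e + g j\<close>
  are moved by no permutation. They recur one surrounding block later, which gives the match.
  Conversely, at any return the copy of block \<open>e + 1\<close> is aligned by
  \<open>recognizable\<close> and, having a fixed index, occupies the same place in its surrounding
  block, so no return is shorter.\<close>

lemma return_time_good:
  assumes W: "tiled (Suc j) W" and good: "q div l j mod N j \<notin> bad_blocks j"
    and x: "\<And>t. t < 2 * l (Suc j) \<Longrightarrow> x (int t) = W (q + t)"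
    and n: "2 * l j \<le> n" "n \<le> g j * l j"
  shows "return_time x n = l (Suc j)"
proof -
  obtain \<rho> where \<rho>: "\<And>b. \<rho> b permutes {1..N j}" "\<And>b i. i \<notin> Pset (N j) \<Longrightarrow> \<rho> b i = i"
    "\<And>b i t. i < N j \<Longrightarrow> t < l j \<Longrightarrow> W (b * l (Suc j) + i * l j + t) = u j (\<rho> b (Suc i)) ! t"
    using tiled_perms[OF W] by metis
  have blocks: "W (f * l j + t) = u j (\<rho> (f div N j) (Suc (f mod N j))) ! t" if "t < l j" for f t
    by (rule tiled_perms_blocks[of j W \<rho>, OF _ that]) (rule \<rho>(3))
  define e where "e = q div l j"
  define r where "r = q mod l j"
  have q: "q = e * l j + r" and r: "r < l j" unfolding e_def r_def by (simp_all add: div_mult_mod_eq)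
  have e_mod: "(e + d) mod N j = e mod N j + d" "Suc ((e + d) mod N j) \<notin> Pset (N j)" if "d \<le> g j" for d
  proof -
    have "e mod N j + d < N j" "Suc (e mod N j + d) \<notin> Pset (N j)"
      using good that unfolding bad_blocks_def e_def[symmetric] by auto
    then show *: "(e + d) mod N j = e mod N j + d" 
      unfolding mod_add_left_eq[of e "N j" d, symmetric] by (intro mod_less)
    show "Suc ((e + d) mod N j) \<notin> Pset (N j)" unfolding * by fact
  qed
  have W_fixed: "W (f * l j + t) = u j (Suc (f mod N j)) ! t"
    if "t < l j" "Suc (f mod N j) \<notin> Pset (N j)" for f t
    using blocks[OF that(1), of f] \<rho>(2)[OF that(2)] by simp
  have "g j * l j \<le> l (Suc j)" using g_bounds(2)[of j] by (simp add: mult.commute)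
  then have nL: "n \<le> l (Suc j)" using n by linarith
  have match: "x (int (l (Suc j)) + int i) = x (int i)" if "i < n" for i
  proof -
    define d where "d = (r + i) div l j"
    define t where "t = (r + i) mod l j"
    have "r + i < Suc (g j) * l j" using r that n by simp
    then have "d < Suc (g j)" unfolding d_def by (rule less_mult_imp_div_less)
    then have d: "d \<le> g j" by simp
    have t: "t < l j" unfolding t_def by simp
    have "r + i = d * l j + t" unfolding d_def t_def by (rule div_mult_mod_eq[symmetric])
    then have qi: "q + i = (e + d) * l j + t" unfolding q by (simp add: algebra_simps)
    have "l (Suc j) + i < 2 * l (Suc j)" using nL that by linarith
    then have "x (int (l (Suc j) + i)) = W (q + (l (Suc j) + i))" by (rule x)
    also have "q + (l (Suc j) + i) = (e + d + N j) * l j + t" using qi by (simp add: algebra_simps)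
    also have "W \<dots> = u j (Suc ((e + d) mod N j)) ! t"
      using W_fixed[OF t, of "e + d + N j"] e_mod(2)[OF d] by simp
    also have "\<dots> = W (q + i)" using W_fixed[OF t e_mod(2)[OF d]] qi by simp
    also have "\<dots> = x (int i)" using nL that by (intro x[symmetric]) linarith
    finally show ?thesis by simp
  qed
  have no_match: "l (Suc j) \<le> k"
    if k: "0 < k" and m: "\<And>i. i < n \<Longrightarrow> x (int k + int i) = x (int i)" for k
  proof (rule ccontr)
    assume "\<not> l (Suc j) \<le> k"
    then have kL: "k < l (Suc j)" by simp
    \<comment> \<open>The distance to the start of block \<open>e + 1\<close>. That whole block lies
      within the first \<open>2 * l j\<close> letters, whence the lower bound on
      \<open>n\<close>.\<close>
    define p where "p = l j - r"
    define i where "i = Suc ((e + 1) mod N j)"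
    have i: "i \<in> {1..N j}" unfolding i_def by (simp add: Suc_leI)
    have iP: "i \<notin> Pset (N j)" unfolding i_def using e_mod(2)[of 1] g_bounds(1)[of j] by simp
    have qp: "q + p = (e + 1) * l j" using r unfolding p_def q by simp
    have eq: "W (q + k + p + t) = u j i ! t" if t: "t < l j" for t
    proof -
      have pt: "p + t < n" using t n r unfolding p_def by linarith
      have "x (int (k + (p + t))) = W (q + (k + (p + t)))" using pt nL kL by (intro x) linarith
      moreover have "x (int (p + t)) = W (q + (p + t))" using pt nL by (intro x) linarith
      ultimately have "W (q + (k + (p + t))) = W (q + (p + t))" using m[OF pt] by simp
      also have "q + (p + t) = (e + 1) * l j + t" using qp by simp
      also have "W \<dots> = u j i ! t" using W_fixed[OF t, of "e + 1"] iP unfolding i_def by simp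
      finally show ?thesis by (simp add: algebra_simps)
    qed
    then have "l j dvd q + k + p" by (intro recognizable[OF tiled_down[OF W] i]) auto
    then obtain f where f: "q + k + p = f * l j" unfolding dvd_def by (auto simp: mult.commute)
    have fm: "Suc (f mod N j) \<in> {1..N j}" by (simp add: Suc_leI)
    have "\<rho> (f div N j) (Suc (f mod N j)) = i"
    proof (rule u_eqI[OF _ i])
      show "\<rho> (f div N j) (Suc (f mod N j)) \<in> {1..N j}" using permutes_in_image[OF \<rho>(1)] fm by blast
      show "u j (\<rho> (f div N j) (Suc (f mod N j))) ! t = u j i ! t" if "t < l j" for t
        using blocks[OF that, of f] eq[OF that] unfolding f by simp
    qed
    moreover have "\<rho> (f div N j) i = i" using \<rho>(2) iP by blast
    ultimately have fe: "f mod N j = (e + 1) mod N j"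
      using injD[OF permutes_inj[OF \<rho>(1), of "f div N j"], of "Suc (f mod N j)" i] unfolding i_def by simp
    have k_eq: "(e + 1) * l j + k = f * l j" using f qp by simp
    then have "(e + 1) * l j < f * l j" using k by linarith
    then have lt: "e + 1 < f" by (simp only: mult_less_cancel2)
    have "N j dvd f - (e + 1)" using mod_eq_dvd_iff_nat[of "e + 1" f "N j"] fe lt by simp
    then have "N j \<le> f - (e + 1)" using lt by (intro dvd_imp_le) auto
    then have "N j * l j \<le> (f - (e + 1)) * l j" by (rule mult_le_mono1)
    also have "\<dots> = k" using k_eq by (simp only: diff_mult_distrib)
    finally show False using kL by (simp add: mult.commute)
  qed
  show ?thesis
    unfolding return_time_def using match no_match l_pos(1)[of "Suc j"] by (intro Least_equality) blast+
qed

section \<open>Frequency of exceptional positions along an orbit\<close>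

lemma card_bad_positions:
  "card {k. k < l (Suc j) \<and> (c + k) div l j mod N j \<in> bad_blocks j} \<le> card (bad_blocks j) * l j"
proof -
  define K where "K = {k. k < l (Suc j) \<and> (c + k) div l j mod N j \<in> bad_blocks j}"
  define h where "h k = ((c + k) div l j mod N j, (c + k) mod l j)" for k
  have inj: "inj_on h K"
  proof (rule inj_onI)
    fix k k' assume k: "k \<in> K" "k' \<in> K" "h k = h k'"
    \<comment> \<open>\<open>h\<close> splits the residue modulo \<open>l (Suc j)\<close> into a
      block and a place in it, and an interval of length \<open>l (Suc j)\<close> meets each residue
      once. The passage to \<open>int\<close> allows \<open>c\<close> to be cancelled.\<close>
    then have "(c + k) mod l (Suc j) = (c + k') mod l (Suc j)"
      unfolding h_def lseq.simps mod_mult2_eq by simp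
    then have "int (c + k) mod int (l (Suc j)) = int (c + k') mod int (l (Suc j))"
      by (simp only: of_nat_mod[symmetric])
    from mod_diff_cong[OF this refl, of "int c"]
    have "int k mod int (l (Suc j)) = int k' mod int (l (Suc j))" by (simp del: lseq.simps)
    moreover have "k < l (Suc j)" "k' < l (Suc j)" using k unfolding K_def by auto
    ultimately show "k = k'" by (simp del: lseq.simps)
  qed
  have "finite (bad_blocks j)" unfolding bad_blocks_def by simp
  then have "card K \<le> card (bad_blocks j \<times> {..<l j})"
    by (intro card_inj_on_le[OF inj]) (auto simp: h_def K_def)
  then show ?thesis unfolding K_def by (simp add: card_cartesian_product)
qed

definition shifted :: "nat \<Rightarrow> (int \<Rightarrow> bool) \<Rightarrow> int \<Rightarrow> bool" where
  "shifted k x = (\<lambda>i. x (int k + i))"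

lemma shifted_subshift:
  assumes "x \<in> marker_subshift l1 u" shows "shifted k x \<in> marker_subshift l1 u"
proof -
  have "map (\<lambda>i. x (int k + a + int i)) [0..<n] \<in> marker_language l1 u" for a n
    using assms unfolding marker_subshift_def by blast
  then show ?thesis unfolding marker_subshift_def shifted_def by (simp add: add.assoc)
qed

text \<open>All scales \<open>n\<close> are put into one event, so that a single exceptional null
  set serves every \<open>\<tau>\<close>.\<close>

definition irregular :: "nat \<Rightarrow> (int \<Rightarrow> bool) set" where
  "irregular j = {x. \<exists>n. 2 * l j \<le> n \<and> n \<le> g j * l j \<and> return_time x n \<noteq> l (Suc j)}"

lemma card_irregular:
  assumes "x \<in> marker_subshift l1 u"
  shows "card {k. k < l (Suc j) \<and> shifted k x \<in> irregular j} \<le> (isqrt (N j) + 3) * (g j + 1) * l j"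
proof -
  \<comment> \<open>Length \<open>3 * l (Suc j)\<close> leaves the \<open>2 * l (Suc j)\<close>
    letters that \<open>return_time_good\<close> requires after each
    \<open>k < l (Suc j)\<close>.\<close>
  obtain W c where W: "tiled (Suc j) W" and x: "\<And>t. t < 3 * l (Suc j) \<Longrightarrow> x (int t) = W (c + t)"
    using subshift_window[OF assms] by metis
  have "{k. k < l (Suc j) \<and> shifted k x \<in> irregular j}
    \<subseteq> {k. k < l (Suc j) \<and> (c + k) div l j mod N j \<in> bad_blocks j}"
  proof safe
    fix k assume k: "k < l (Suc j)" "shifted k x \<in> irregular j"
    show "(c + k) div l j mod N j \<in> bad_blocks j"
    proof (rule ccontr)
      assume good: "(c + k) div l j mod N j \<notin> bad_blocks j"
      have "shifted k x (int t) = W (c + k + t)" if "t < 2 * l (Suc j)" for t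
        using x[of "k + t"] that k unfolding shifted_def by (simp add: add.assoc del: lseq.simps)
      then show False
        using return_time_good[OF W good] k(2) unfolding irregular_def by blast
    qed
  qed
  then have "card {k. k < l (Suc j) \<and> shifted k x \<in> irregular j}
    \<le> card {k. k < l (Suc j) \<and> (c + k) div l j mod N j \<in> bad_blocks j}"
    by (intro card_mono) auto
  also have "\<dots> \<le> card (bad_blocks j) * l j" by (rule card_bad_positions)
  also have "\<dots> \<le> (isqrt (N j) + 3) * (g j + 1) * l j" by (intro mult_le_mono1 card_bad_blocks)
  finally show ?thesis .
qed

text \<open>Formulated without \<open>return_time\<close>, whose \<open>LEAST\<close> is unspecified
  at a point that never returns.\<close>

definition late :: "nat \<Rightarrow> nat \<Rightarrow> (int \<Rightarrow> bool) set" where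
  "late n T = {x. \<forall>k. 0 < k \<and> k \<le> T \<longrightarrow> (\<exists>i<n. x (int k + int i) \<noteq> x (int i))}"

text \<open>Two times up to \<open>T\<close> with the same \<open>n\<close>-word would make the
  earlier one return within \<open>T\<close>, so late times carry distinct words.\<close>

lemma card_late:
  assumes "x \<in> marker_subshift l1 u" "l1 \<le> n"
  shows "real (card {k. k < Suc T \<and> shifted k x \<in> late n T}) \<le> exp (15 * sqrt (real n))"
proof -
  define w where "w k = map (\<lambda>i. shifted k x (int i)) [0..<n]" for k
  have *: "k' \<le> k" if late: "shifted k x \<in> late n T" "k' \<le> T" "w k = w k'" for k k'
  proof (rule ccontr)
    assume "\<not> k' \<le> k"
    then have d: "0 < k' - k \<and> k' - k \<le> T" "int (k' - k) = int k' - int k" using late by auto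
    then obtain i where i: "i < n" "shifted k x (int (k' - k) + int i) \<noteq> shifted k x (int i)"
      using late(1) unfolding late_def mem_Collect_eq by blast
    moreover have "w k ! i = w k' ! i" using late(3) by simp
    ultimately show False using d(2) by (simp add: w_def shifted_def)
  qed
  have "inj_on w {k. k < Suc T \<and> shifted k x \<in> late n T}"
    by (intro inj_onI antisym) (auto intro: *)
  moreover have "w k \<in> words n" for k
    unfolding w_def words_def using shifted_subshift[OF assms(1)] by blast
  ultimately have "card {k. k < Suc T \<and> shifted k x \<in> late n T} \<le> card (words n)"
    using card_words_exp(1)[OF assms(2)] by (intro card_inj_on_le) auto
  then show ?thesis using card_words_exp(2)[OF assms(2)] by linarith
qed

subsection \<open>Scales realizing a given critical value\<close>

lemma l_ge_1: "1 \<le> real (l j)"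
  using l_pos(1)[of j] by linarith

text \<open>Multiplying \<open>N j \<ge> 2 ^ j\<close> over the levels yields an exponent quadratic
  in \<open>j\<close>, which later beats the factors \<open>8 ^ j\<close>. Squaring
  \<open>l j\<close> avoids halves in the exponent.\<close>

lemma l_ge_power: "2 ^ (j\<^sup>2) \<le> (l j)\<^sup>2"
proof (induction j)
  case 0
  then show ?case using l1_ge by simp
next
  case (Suc j)
  have "(2::nat) ^ (Suc j)\<^sup>2 = 2 ^ (j\<^sup>2) * 2 * (2 ^ j)\<^sup>2"
    by (simp add: power2_eq_square power_add)
  also have "\<dots> \<le> 2 ^ (j\<^sup>2) * (1024 * 2 ^ j)\<^sup>2"
    by (simp add: power_mult_distrib)
  also have "\<dots> \<le> (l j)\<^sup>2 * (N j)\<^sup>2"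
    using N_ge Suc by (intro mult_le_mono power_mono) auto
  finally show ?case by (simp add: power_mult_distrib)
qed

lemma ln_l_ge: "real j ^ 2 * (ln 2 / 2) \<le> ln (real (l j))"
proof -
  have "(2::real) ^ (j\<^sup>2) \<le> real (l j) ^ 2"
    using l_ge_power[of j] by (metis of_nat_le_iff of_nat_numeral of_nat_power)
  then have "ln ((2::real) ^ (j\<^sup>2)) \<le> ln (real (l j) ^ 2)" by (subst ln_le_cancel_iff) simp_all
  then show ?thesis by (simp add: ln_realpow)
qed

lemma l_powr_div_at_top:
  assumes "0 < \<delta>" shows "filterlim (\<lambda>j. real (l j) powr \<delta> / 8 ^ j) at_top sequentially"
proof (rule filterlim_at_top_mono)
  show "filterlim (\<lambda>j::nat. exp (\<delta> * (real j ^ 2 * (ln 2 / 2)) - real j * ln 8)) at_top sequentially"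
    using assms by real_asymp
  show "\<forall>\<^sub>F j in sequentially. exp (\<delta> * (real j ^ 2 * (ln 2 / 2)) - real j * ln 8) \<le> real (l j) powr \<delta> / 8 ^ j"
  proof (intro always_eventually allI)
    fix j
    have "exp (\<delta> * (real j ^ 2 * (ln 2 / 2)) - real j * ln 8) \<le> exp (\<delta> * ln (real (l j)) - real j * ln 8)"
      using ln_l_ge[of j] assms by (simp add: mult_left_mono)
    also have "\<dots> = real (l j) powr \<delta> / 8 ^ j"
      by (simp add: exp_diff powr_def exp_of_nat_mult)
    finally show "exp (\<delta> * (real j ^ 2 * (ln 2 / 2)) - real j * ln 8) \<le> real (l j) powr \<delta> / 8 ^ j" .
  qed
qed

lemma l_at_top: "filterlim (\<lambda>j. real (l j)) at_top sequentially"
  by (rule filterlim_compose[OF filterlim_real_sequentially filterlim_subseq[OF l_strict_mono]])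

lemma g_ge: "real (N j) powr (1/4) / 4 \<le> real (g j)"
proof -
  have isq: "sqrt (real n) / 2 \<le> real (isqrt n)" if "4 \<le> n" for n
  proof -
    have "2 \<le> sqrt (real n)" using that by (intro real_le_rsqrt) simp
    then show ?thesis using isqrt_gt[of n] by linarith
  qed
  have m: "4 \<le> isqrt (N j)" using N_ge_1024[of j] by (simp add: le_isqrt_iff)
  have "real (N j) powr (1/4) / 4 = sqrt (sqrt (real (N j))) / 2 / 2"
    by (simp add: powr_powr flip: powr_half_sqrt)
  also have "\<dots> \<le> sqrt (sqrt (real (N j)) / 2) / 2"
  proof -
    have "sqrt (sqrt (real (N j))) / sqrt 4 \<le> sqrt (sqrt (real (N j))) / sqrt 2"
      by (intro divide_left_mono real_sqrt_le_mono) auto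
    then show ?thesis by (simp add: real_sqrt_divide mult.commute)
  qed
  also have "\<dots> \<le> sqrt (real (isqrt (N j))) / 2"
    using isq[of "N j"] N_ge_1024[of j] by simp
  also have "\<dots> \<le> real (g j)" unfolding g_def by (rule isq[OF m])
  finally show ?thesis .
qed

lemma ln_l_Suc: "ln (real (l (Suc j))) = ln (real (l j)) + ln (real (N j))"
  by (simp add: ln_mult)

text \<open>For such \<open>x\<close> the return times at these scales are eventually the
  deterministic \<open>l (Suc j)\<close>, so the sequence can be tested without reference to the
  point.\<close>

lemma critical_value_lim_if_regular:
  fixes nj :: "nat \<Rightarrow> nat"
  assumes bounds: "\<forall>\<^sub>F j in sequentially. 2 * l j \<le> nj j \<and> nj j \<le> g j * l j"
    and low: "\<And>\<beta>. 0 < \<beta> \<Longrightarrow> \<beta> < \<tau> \<Longrightarrow>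
      filterlim (\<lambda>j. ln (real (l (Suc j))) / real (nj j) powr \<beta>) at_top sequentially"
    and high: "\<And>\<beta>. \<tau> < \<beta> \<Longrightarrow> (\<lambda>j. ln (real (l (Suc j))) / real (nj j) powr \<beta>) \<longlonglongrightarrow> 0"
    and x: "\<forall>\<^sub>F j in sequentially. x \<notin> irregular j"
  shows "has_critical_value_lim
    (\<lambda>\<beta> j. ereal (ln (real (return_time x (nj j))) / real (nj j) powr \<beta>)) \<tau>"
proof -
  have eq: "\<forall>\<^sub>F j in sequentially. ereal (ln (real (l (Suc j))) / real (nj j) powr \<beta>)
      = ereal (ln (real (return_time x (nj j))) / real (nj j) powr \<beta>)" for \<beta>
    using bounds x
  proof eventually_elim
    case (elim j)
    then have "return_time x (nj j) = l (Suc j)" unfolding irregular_def by blast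
    then show ?case by (simp only:)
  qed
  show ?thesis
    unfolding has_critical_value_lim_def
  proof (intro conjI allI impI)
    fix \<beta> assume "0 < \<beta> \<and> \<beta> < \<tau>"
    then have "(\<lambda>j. ereal (ln (real (l (Suc j))) / real (nj j) powr \<beta>)) \<longlonglongrightarrow> \<infinity>"
      using low unfolding tendsto_PInfty_eq_at_top by blast
    then show "(\<lambda>j. ereal (ln (real (return_time x (nj j))) / real (nj j) powr \<beta>)) \<longlonglongrightarrow> \<infinity>"
      using eq by (rule Lim_transform_eventually)
  next
    fix \<beta> assume "\<tau> < \<beta>"
    then have "(\<lambda>j. ereal (ln (real (l (Suc j))) / real (nj j) powr \<beta>)) \<longlonglongrightarrow> ereal 0"
      using high by (intro tendsto_ereal)
    then show "(\<lambda>j. ereal (ln (real (return_time x (nj j))) / real (nj j) powr \<beta>)) \<longlonglongrightarrow> 0"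
      using eq unfolding zero_ereal_def by (rule Lim_transform_eventually)
  qed
qed

text \<open>At the top of the admissible range, \<open>n\<close> is at least a quarter of
  \<open>l (Suc j) powr (1/4)\<close>, so \<open>ln (l (Suc j))\<close> is negligible against every
  positive power of \<open>n\<close>.\<close>

lemma scale_zero:
  fixes \<beta> :: real
  assumes "0 < \<beta>"
  shows "(\<lambda>j. ln (real (l (Suc j))) / real (g j * l j) powr \<beta>) \<longlonglongrightarrow> 0"
proof (rule tendsto_sandwich[where f = "\<lambda>_. 0"])
  have "((\<lambda>y::real. ln y / (y powr (1/4) / 4) powr \<beta>) \<longlongrightarrow> 0) at_top"
    using assms by real_asymp
  then show "(\<lambda>j. ln (real (l (Suc j))) / (real (l (Suc j)) powr (1/4) / 4) powr \<beta>) \<longlonglongrightarrow> 0"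
    by (rule filterlim_compose[OF _ filterlim_compose[OF l_at_top filterlim_Suc]])
  show "\<forall>\<^sub>F j in sequentially. ln (real (l (Suc j))) / real (g j * l j) powr \<beta>
    \<le> ln (real (l (Suc j))) / (real (l (Suc j)) powr (1/4) / 4) powr \<beta>"
  proof (intro always_eventually allI frac_le powr_mono2)
    fix j
    have "real (l j) powr (1/4) \<le> real (l j) powr 1"
      using l_ge_1[of j] by (intro powr_mono) auto
    then have "real (l j) powr (1/4) * (real (N j) powr (1/4) / 4) \<le> real (l j) * real (g j)"
      using g_ge[of j] l_ge_1[of j] by (intro mult_mono) auto
    then show "real (l (Suc j)) powr (1/4) / 4 \<le> real (g j * l j)"
      by (simp add: powr_mult mult.commute)
    show "0 \<le> ln (real (l (Suc j)))" using l_ge_1 by (intro ln_ge_zero)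
    show "0 < (real (l (Suc j)) powr (1/4) / 4) powr \<beta>"
      using l_pos(1)[of "Suc j"] by (intro divide_pos_pos powr_pos) simp_all
  qed (use assms in auto)
  show "\<forall>\<^sub>F j in sequentially. 0 \<le> ln (real (l (Suc j))) / real (g j * l j) powr \<beta>"
    by (intro always_eventually allI divide_nonneg_nonneg ln_ge_zero l_ge_1) simp
qed simp

text \<open>Used with \<open>a = 1 / (2 * \<tau>)\<close>, so that the power \<open>\<tau>\<close>
  of the scale is comparable with \<open>sqrt (l j)\<close>. The factor 2 outside the floor keeps
  the scale at or above \<open>2 * l j\<close> even for \<open>a = 1\<close>.\<close>

definition scale_seq :: "real \<Rightarrow> nat \<Rightarrow> nat" where
  "scale_seq a j = 2 * nat \<lfloor>real (l j) powr a\<rfloor>"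

lemma scale_bounds:
  assumes "1 \<le> a"
  shows "2 * l j \<le> scale_seq a j" "real (l j) powr a \<le> real (scale_seq a j)"
    "real (scale_seq a j) \<le> 2 * real (l j) powr a"
proof -
  have la: "real (l j) \<le> real (l j) powr a"
    using l_ge_1[of j] powr_mono[of 1 a "real (l j)"] assms by simp
  then show "2 * l j \<le> scale_seq a j" unfolding scale_seq_def by (simp add: le_nat_floor)
  have "1 \<le> real (l j) powr a" using la l_ge_1[of j] by linarith
  moreover define m where "m = nat \<lfloor>real (l j) powr a\<rfloor>"
  ultimately have m: "1 \<le> m" "real m \<le> real (l j) powr a" "real (l j) powr a < real m + 1"
    by (simp add: le_nat_floor, linarith, linarith)
  have eq: "real (scale_seq a j) = 2 * real m" unfolding scale_seq_def m_def by simp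
  show "real (l j) powr a \<le> real (scale_seq a j)" using m unfolding eq by linarith
  show "real (scale_seq a j) \<le> 2 * real (l j) powr a" using m unfolding eq by linarith
qed

lemma scale_strict_mono:
  assumes "1 \<le> a" shows "strict_mono (scale_seq a)"
  unfolding strict_mono_Suc_iff
proof
  fix j
  have "real (l j) powr a + 1 \<le> 2 * real (l j) powr a"
    using l_ge_1[of j] assms by (simp add: ge_one_powr_ge_zero)
  also have "\<dots> \<le> 2 powr a * real (l j) powr a"
    using powr_mono[of 1 a 2] assms by (intro mult_right_mono) auto
  also have "\<dots> = (2 * real (l j)) powr a" by (simp add: powr_mult)
  also have "\<dots> \<le> real (l (Suc j)) powr a"
  proof (intro powr_mono2)
    show "2 * real (l j) \<le> real (l (Suc j))"
      using l_double[of j] unfolding of_nat_le_iff[symmetric, where 'a = real] of_nat_mult by simp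
  qed (use assms in auto)
  finally have *: "real (l j) powr a + 1 \<le> real (l (Suc j)) powr a" .
  have "0 \<le> real (l j) powr a" by simp
  then show "scale_seq a j < scale_seq a (Suc j)" using * unfolding scale_seq_def by linarith
qed

lemma scale_le_g:
  assumes "1 \<le> a" shows "\<forall>\<^sub>F j in sequentially. scale_seq a j \<le> g j * l j"
proof -
  \<comment> \<open>The 8 is the 2 of \<open>scale_bounds\<close> times the 4 of
    \<open>g_ge\<close>.\<close>
  have "\<forall>\<^sub>F y in at_top. ln 8 + a * ln y \<le> y powr (1/4) / 4"
    using assms by real_asymp
  then have "\<forall>\<^sub>F j in sequentially. ln 8 + a * ln (real (l j)) \<le> real (l j) powr (1/4) / 4"
    using l_at_top by (rule eventually_compose_filterlim)
  \<comment> \<open>This absorbs the denominator \<open>2 * 8 ^ j\<close> of \<open>ln_N_ge\<close>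
    at the cost of weakening \<open>sqrt (l j)\<close> to \<open>l j powr (1/4)\<close>.\<close>
  moreover have "\<forall>\<^sub>F j in sequentially. 2 \<le> real (l j) powr (1/4) / 8 ^ j"
    using l_powr_div_at_top[of "1/4"] unfolding filterlim_at_top by simp
  ultimately show ?thesis
  proof eventually_elim
    case (elim j)
    have "real (l j) powr (1/4) * 2 \<le> real (l j) powr (1/4) * (real (l j) powr (1/4) / 8 ^ j)"
      using elim(2) by (intro mult_left_mono) auto
    also have "\<dots> = sqrt (real (l j)) / 8 ^ j"
      unfolding times_divide_eq_right powr_add[symmetric] by (simp add: powr_half_sqrt)
    finally have "real (l j) powr (1/4) \<le> sqrt (real (l j)) / (2 * 8 ^ j)" by simp
    also have "\<dots> \<le> ln (real (N j))" by (rule ln_N_ge)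
    finally have "ln 8 + a * ln (real (l j)) \<le> ln (real (N j)) / 4" using elim(1) by linarith
    then have "exp (ln 8 + a * ln (real (l j))) \<le> exp (ln (real (N j)) / 4)" by simp
    then have "8 * real (l j) powr a \<le> real (N j) powr (1/4)"
      by (simp add: exp_add powr_def)
    then have "real (scale_seq a j) \<le> real (g j)"
      using g_ge[of j] scale_bounds(3)[OF assms, of j] by linarith
    then have "scale_seq a j \<le> g j * 1" by simp
    also have "\<dots> \<le> g j * l j" using l_pos(1)[of j] by (intro mult_le_mono2) linarith
    finally show ?case .
  qed
qed

text \<open>The quotient is at least a constant times
  \<open>l j powr (1/2 - a * \<beta>) / 8 ^ j\<close>, and a positive power of \<open>l j\<close>
  outgrows the loss \<open>8 ^ j\<close>.\<close>

lemma scale_below: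
  assumes a: "1 \<le> a" and "0 < \<beta>" "a * \<beta> < 1/2"
  shows "filterlim (\<lambda>j. ln (real (l (Suc j))) / real (scale_seq a j) powr \<beta>) at_top sequentially"
proof (rule filterlim_at_top_mono)
  have "filterlim (\<lambda>j. (1 / (2 * 2 powr \<beta>)) * (real (l j) powr (1/2 - a * \<beta>) / 8 ^ j)) at_top sequentially"
    using assms(3) by (intro filterlim_tendsto_pos_mult_at_top[OF tendsto_const] l_powr_div_at_top) auto
  then show "filterlim (\<lambda>j. (1 / (2 * 2 powr \<beta>)) * (real (l j) powr (1/2 - a * \<beta>) / 8 ^ j)) at_top sequentially" .
  show "\<forall>\<^sub>F j in sequentially. (1 / (2 * 2 powr \<beta>)) * (real (l j) powr (1/2 - a * \<beta>) / 8 ^ j)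
    \<le> ln (real (l (Suc j))) / real (scale_seq a j) powr \<beta>"
  proof (intro always_eventually allI)
    fix j
    have "real (scale_seq a j) powr \<beta> \<le> (2 * real (l j) powr a) powr \<beta>"
      using scale_bounds(3)[OF a, of j] assms by (intro powr_mono2) auto
    also have "\<dots> = 2 powr \<beta> * real (l j) powr (a * \<beta>)" by (simp add: powr_mult powr_powr)
    finally have s: "real (scale_seq a j) powr \<beta> \<le> 2 powr \<beta> * real (l j) powr (a * \<beta>)" .
    have pos: "0 < real (scale_seq a j) powr \<beta>"
      using order_less_le_trans[OF _ scale_bounds(1)[OF a, of j], of 0] l_pos(1)[of j] by simp
    have "(1 / (2 * 2 powr \<beta>)) * (real (l j) powr (1/2 - a * \<beta>) / 8 ^ j)
      = (sqrt (real (l j)) / (2 * 8 ^ j)) / (2 powr \<beta> * real (l j) powr (a * \<beta>))"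
      by (simp add: powr_diff powr_half_sqrt)
    also have "\<dots> \<le> ln (real (N j)) / real (scale_seq a j) powr \<beta>"
      using s pos ln_N_ge[of j] N_ge_1024[of j] by (intro frac_le) auto
    also have "\<dots> \<le> ln (real (l (Suc j))) / real (scale_seq a j) powr \<beta>"
      unfolding ln_l_Suc using l_ge_1[of j] by (intro divide_right_mono) auto
    finally show "(1 / (2 * 2 powr \<beta>)) * (real (l j) powr (1/2 - a * \<beta>) / 8 ^ j)
      \<le> ln (real (l (Suc j))) / real (scale_seq a j) powr \<beta>" .
  qed
qed

text \<open>The numerator is at most \<open>3 * sqrt (l j)\<close>, where \<open>ln (l j)\<close>
  accounts for 2 and \<open>ln (N j)\<close> for 1.\<close>

lemma scale_above:
  assumes a: "1 \<le> a" and "0 < \<beta>" "1/2 < a * \<beta>"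
  shows "(\<lambda>j. ln (real (l (Suc j))) / real (scale_seq a j) powr \<beta>) \<longlonglongrightarrow> 0"
proof (rule tendsto_sandwich[where f = "\<lambda>_. 0"])
  have "((\<lambda>y::real. 3 * sqrt y / y powr (a * \<beta>)) \<longlongrightarrow> 0) at_top"
    using assms(3) by real_asymp
  then show "(\<lambda>j. 3 * sqrt (real (l j)) / real (l j) powr (a * \<beta>)) \<longlonglongrightarrow> 0"
    using l_at_top by (rule filterlim_compose)
  show "\<forall>\<^sub>F j in sequentially. ln (real (l (Suc j))) / real (scale_seq a j) powr \<beta>
    \<le> 3 * sqrt (real (l j)) / real (l j) powr (a * \<beta>)"
  proof (intro always_eventually allI frac_le)
    fix j
    show "ln (real (l (Suc j))) \<le> 3 * sqrt (real (l j))"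
      unfolding ln_l_Suc using ln_N_le[of j] ln_le_2_sqrt[OF l_ge_1[of j]] by linarith
    have "(real (l j) powr a) powr \<beta> \<le> real (scale_seq a j) powr \<beta>"
      using scale_bounds(2)[OF a, of j] assms by (intro powr_mono2) auto
    then show "real (l j) powr (a * \<beta>) \<le> real (scale_seq a j) powr \<beta>" by (simp add: powr_powr)
    show "0 < real (l j) powr (a * \<beta>)" by simp
  qed simp
  show "\<forall>\<^sub>F j in sequentially. 0 \<le> ln (real (l (Suc j))) / real (scale_seq a j) powr \<beta>"
    by (intro always_eventually allI divide_nonneg_nonneg ln_ge_zero l_ge_1) simp
qed simp

lemma critical_value_lim_exists:
  assumes "0 \<le> \<tau>" "\<tau> \<le> 1/2"
  obtains nj :: "nat \<Rightarrow> nat" where "strict_mono nj"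
    "\<And>x. \<forall>\<^sub>F j in sequentially. x \<notin> irregular j \<Longrightarrow> has_critical_value_lim
      (\<lambda>\<beta> j. ereal (ln (real (return_time x (nj j))) / real (nj j) powr \<beta>)) \<tau>"
proof (cases "\<tau> = 0")
  case True
  have "strict_mono (\<lambda>j. g j * l j)"
    unfolding strict_mono_Suc_iff
  proof
    fix j
    have "g j \<le> g (Suc j)" unfolding g_def using N_double[of j] by (intro mono_isqrt) simp
    then have "g j * l j \<le> g (Suc j) * l j" by (rule mult_le_mono1)
    also have "\<dots> < g (Suc j) * l (Suc j)"
      using g_bounds(1)[of "Suc j"] strict_monoD[OF l_strict_mono, of j "Suc j"]
      by (intro mult_strict_left_mono) auto
    finally show "g j * l j < g (Suc j) * l (Suc j)" .
  qed
  moreover have "has_critical_value_lim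
      (\<lambda>\<beta> j. ereal (ln (real (return_time x (g j * l j))) / real (g j * l j) powr \<beta>)) \<tau>"
    if "\<forall>\<^sub>F j in sequentially. x \<notin> irregular j" for x
    using that scale_zero True g_bounds(1)
    by (intro critical_value_lim_if_regular) (simp_all del: of_nat_mult lseq.simps)
  ultimately show ?thesis by (rule that)
next
  case False
  define a where "a = 1 / (2 * \<tau>)"
  \<comment> \<open>The bound \<open>\<tau> \<le> 1/2\<close> enters here: it keeps the scales at or
    above \<open>2 * l j\<close>.\<close>
  have a: "1 \<le> a" using assms False unfolding a_def by simp
  have bounds: "\<forall>\<^sub>F j in sequentially. 2 * l j \<le> scale_seq a j \<and> scale_seq a j \<le> g j * l j"
    using scale_le_g[OF a] by eventually_elim (use scale_bounds(1)[OF a] in blast)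
  have tau: "a * \<beta> < 1/2 \<longleftrightarrow> \<beta> < \<tau>" "1/2 < a * \<beta> \<longleftrightarrow> \<tau> < \<beta>" for \<beta>
    using assms False unfolding a_def by (auto simp: field_simps)
  show ?thesis
  proof (rule that[OF scale_strict_mono[OF a]])
    fix x assume "\<forall>\<^sub>F j in sequentially. x \<notin> irregular j"
    then show "has_critical_value_lim
      (\<lambda>\<beta> j. ereal (ln (real (return_time x (scale_seq a j))) / real (scale_seq a j) powr \<beta>)) \<tau>"
      using scale_below[OF a] scale_above[OF a] tau assms
      by (intro critical_value_lim_if_regular[OF bounds]) auto
  qed
qed

end

subsection \<open>Almost sure statements\<close>

locale marker_measure = marker l1 u + prob_space \<mu>
  for l1 u and \<mu> :: "(int \<Rightarrow> bool) measure" +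
  assumes sets_\<mu>: "sets \<mu> = sets (Pi\<^sub>M UNIV (\<lambda>_::int. count_space (UNIV :: bool set)))"
    and AE_subshift: "AE x in \<mu>. x \<in> marker_subshift l1 u"
    and shift_invariant: "\<forall>A\<in>sets \<mu>. emeasure \<mu> (shift -` A \<inter> space \<mu>) = emeasure \<mu> A"
begin

lemma space_\<mu> [simp]: "space \<mu> = UNIV"
  using sets_eq_imp_space_eq[OF sets_\<mu>] by (simp add: space_PiM)

lemma measurable_coordinate [measurable]: "Measurable.pred \<mu> (\<lambda>x. x i)"
  unfolding measurable_cong_sets[OF sets_\<mu> refl] by (rule measurable_component_singleton) simp

lemma measurable_shifted: "shifted k \<in> measurable \<mu> \<mu>"
  unfolding measurable_cong_sets[OF refl sets_\<mu>] shifted_def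
  by (intro measurable_PiM_single') (auto simp: space_PiM)

lemma sets_late [measurable]: "late n T \<in> sets \<mu>"
proof -
  have "{x \<in> space \<mu>. \<forall>k. 0 < k \<and> k \<le> T \<longrightarrow> (\<exists>i<n. x (int k + int i) \<noteq> x (int i))} \<in> sets \<mu>"
    by measurable
  then show ?thesis unfolding late_def by simp
qed

lemma measurable_return_time [measurable]:
  "(\<lambda>x. return_time x n) \<in> measurable \<mu> (count_space UNIV)"
  unfolding return_time_def by measurable

lemma sets_irregular [measurable]: "irregular j \<in> sets \<mu>"
proof -
  have "{x \<in> space \<mu>. \<exists>n. 2 * l j \<le> n \<and> n \<le> g j * l j \<and> return_time x n \<noteq> l (Suc j)} \<in> sets \<mu>"
    by measurable
  then show ?thesis unfolding irregular_def by simp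
qed

text \<open>Words form a countable type, so quantifying over them reduces membership to countable
  combinations of coordinate events.\<close>

lemma sets_subshift [measurable]: "marker_subshift l1 u \<in> sets \<mu>"
proof -
  have "map (\<lambda>k. x (a + int k)) [0..<n] \<in> marker_language l1 u \<longleftrightarrow>
    (\<exists>v. v \<in> marker_language l1 u \<and> length v = n \<and> (\<forall>k<n. x (a + int k) \<longleftrightarrow> v ! k))" for x a n
  proof
    assume "map (\<lambda>k. x (a + int k)) [0..<n] \<in> marker_language l1 u"
    then show "\<exists>v. v \<in> marker_language l1 u \<and> length v = n \<and> (\<forall>k<n. x (a + int k) \<longleftrightarrow> v ! k)"
      by (intro exI[of _ "map (\<lambda>k. x (a + int k)) [0..<n]"]) simp
  next
    assume "\<exists>v. v \<in> marker_language l1 u \<and> length v = n \<and> (\<forall>k<n. x (a + int k) \<longleftrightarrow> v ! k)"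
    then obtain v where v: "v \<in> marker_language l1 u" "length v = n" "\<forall>k<n. x (a + int k) \<longleftrightarrow> v ! k"
      by blast
    then have "map (\<lambda>k. x (a + int k)) [0..<n] = v" by (intro nth_equalityI) auto
    with v(1) show "map (\<lambda>k. x (a + int k)) [0..<n] \<in> marker_language l1 u" by simp
  qed
  then have "marker_subshift l1 u = {x \<in> space \<mu>. \<forall>a n. \<exists>v. v \<in> marker_language l1 u \<and> length v = n \<and>
    (\<forall>k<n. x (a + int k) \<longleftrightarrow> v ! k)}"
    unfolding marker_subshift_def by simp
  also have "\<dots> \<in> sets \<mu>" by measurable
  finally show ?thesis .
qed

lemma emeasure_shifted:
  assumes "B \<in> sets \<mu>" shows "emeasure \<mu> (shifted k -` B) = emeasure \<mu> B"
proof (induction k)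
  case 0
  then show ?case by (simp add: shifted_def)
next
  case (Suc k)
  have "shifted (Suc k) = shifted k \<circ> shift"
    by (auto simp: fun_eq_iff shifted_def shift_def algebra_simps)
  then have "shifted (Suc k) -` B = shift -` (shifted k -` B)" by auto
  moreover have "shifted k -` B \<in> sets \<mu>" using measurable_sets[OF measurable_shifted assms] by simp
  ultimately show ?case using shift_invariant Suc by simp
qed

text \<open>By invariance \<open>M * prob B\<close> is the expected number of visits to
  \<open>B\<close> among the first \<open>M\<close> shifts. This turns counts along orbits into
  bounds on probabilities.\<close>

lemma prob_le_frequency:
  assumes B: "B \<in> sets \<mu>"
    and D: "\<And>x. x \<in> marker_subshift l1 u \<Longrightarrow> real (card {k. k < M \<and> shifted k x \<in> B}) \<le> D"
  shows "real M * prob B \<le> D"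
proof -
  have sh: "shifted k -` B \<in> sets \<mu>" for k using measurable_sets[OF measurable_shifted B] by simp
  have count: "(\<Sum>k<M. indicat_real (shifted k -` B) x) = real (card {k. k < M \<and> shifted k x \<in> B})" for x
  proof -
    have "(\<Sum>k<M. indicat_real (shifted k -` B) x) = (\<Sum>k<M. of_bool (shifted k x \<in> B))"
      by (intro sum.cong) (auto simp: indicator_def)
    also have "\<dots> = real (card ({..<M} \<inter> {k. shifted k x \<in> B}))" by (simp add: sum_of_bool_eq)
    also have "{..<M} \<inter> {k. shifted k x \<in> B} = {k. k < M \<and> shifted k x \<in> B}" by auto
    finally show ?thesis .
  qed
  have "real M * prob B = (\<Sum>k<M. prob (shifted k -` B))"
    using emeasure_shifted[OF B] by (simp add: measure_def)
  also have "\<dots> = (\<Sum>k<M. expectation (indicat_real (shifted k -` B)))"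
    using sh by simp
  also have "\<dots> = expectation (\<lambda>x. \<Sum>k<M. indicat_real (shifted k -` B) x)"
    using sh by (intro Bochner_Integration.integral_sum[symmetric]) (auto simp: emeasure_eq_measure)
  also have "\<dots> \<le> expectation (\<lambda>_. D)"
  proof (rule integral_mono_AE)
    show "integrable \<mu> (\<lambda>x. \<Sum>k<M. indicat_real (shifted k -` B) x)"
      using sh by (intro Bochner_Integration.integrable_sum) (auto simp: emeasure_eq_measure)
    show "AE x in \<mu>. (\<Sum>k<M. indicat_real (shifted k -` B) x) \<le> D"
      using AE_subshift by eventually_elim (use D in \<open>simp add: count\<close>)
  qed simp
  finally show ?thesis using prob_space by simp
qed

text \<open>The proportion of irregular positions is at most of order
  \<open>N j powr (-1/4)\<close>, and \<open>N j \<ge> 2 ^ j\<close> makes this geometrically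
  small.\<close>

lemma prob_irregular: "prob (irregular j) \<le> 8 * (1 / sqrt (sqrt 2)) ^ j"
proof -
  define q where "q = sqrt (sqrt (real (N j)))"
  have q1: "1 \<le> q" using N_ge_1024[of j] unfolding q_def by simp
  have q2: "q\<^sup>2 = sqrt (real (N j))" unfolding q_def by simp
  have q4: "q ^ 4 = real (N j)"
    using power_mult[of q 2 2] q2 by simp
  have i: "real (isqrt (N j)) \<le> q\<^sup>2" using isqrt_le[of "N j"] q2 by simp
  have "real (g j) \<le> sqrt (real (isqrt (N j)))" unfolding g_def by (rule isqrt_le)
  also have "\<dots> \<le> q" unfolding q_def using isqrt_le[of "N j"] by simp
  finally have g: "real (g j) \<le> q" .
  have "real (l (Suc j)) * prob (irregular j) \<le> real ((isqrt (N j) + 3) * (g j + 1) * l j)"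
    using card_irregular by (intro prob_le_frequency sets_irregular) (simp only: of_nat_le_iff)
  then have "real (l j) * (real (N j) * prob (irregular j)) \<le> real (l j) * ((real (isqrt (N j)) + 3) * (real (g j) + 1))"
    by (simp only: lseq.simps of_nat_mult of_nat_add of_nat_1 of_nat_numeral mult_ac)
  then have "real (N j) * prob (irregular j) \<le> (real (isqrt (N j)) + 3) * (real (g j) + 1)"
    using l_pos(1)[of j] by (simp only: mult_le_cancel_left_pos of_nat_0_less_iff)
  also have "\<dots> \<le> (4 * q\<^sup>2) * (2 * q)"
    using i g q1 one_le_power[OF q1, of 2] by (intro mult_mono; linarith)
  finally have "q * prob (irregular j) * q ^ 3 \<le> 8 * q ^ 3"
    unfolding q4[symmetric] by (simp add: power2_eq_square power3_eq_cube power4_eq_xxxx mult_ac)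
  then have "q * prob (irregular j) \<le> 8" using q1 by simp
  then have "prob (irregular j) \<le> 8 * (1 / q)" using q1 by (simp add: field_simps)
  also have "1 / q \<le> (1 / sqrt (sqrt 2)) ^ j"
  proof -
    have "2 ^ j \<le> N j" using N_ge[of j] by (rule order_trans[rotated]) simp
    then have "2 ^ j \<le> real (N j)" by (metis of_nat_le_iff of_nat_numeral of_nat_power)
    then have "sqrt (sqrt (2 ^ j)) \<le> q" unfolding q_def by simp
    then have "(sqrt (sqrt 2)) ^ j \<le> q" by (simp add: real_sqrt_power)
    then show ?thesis unfolding power_one_over by (intro divide_left_mono) (use q1 in auto)
  qed
  finally show ?thesis by simp
qed

lemma AE_regular: "AE x in \<mu>. \<forall>\<^sub>F j in sequentially. x \<notin> irregular j"
proof -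
  have "1 < sqrt (sqrt (2::real))" by simp
  then have "summable (\<lambda>j. 8 * (1 / sqrt (sqrt (2::real))) ^ j)"
    by (intro summable_mult summable_geometric) simp
  then have "summable (\<lambda>j. prob (irregular j))"
    by (rule summable_comparison_test'[where N = 0]) (use prob_irregular in auto)
  from borel_cantelli_AE1[OF sets_irregular _ this] show ?thesis
    by (simp add: emeasure_eq_measure)
qed

text \<open>The factor \<open>n ^ 2\<close> makes the probabilities of \<open>late\<close> summable
  and adds only \<open>2 * ln n\<close> to the logarithm of the return time.\<close>

definition horizon :: "nat \<Rightarrow> nat" where
  "horizon n = nat \<lfloor>real n ^ 2 * exp (15 * sqrt (real n))\<rfloor>"

lemma AE_not_late: "AE x in \<mu>. \<forall>\<^sub>F n in sequentially. x \<notin> late n (horizon n)"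
proof -
  have bound: "prob (late n (horizon n)) \<le> 1 / real n ^ 2" if n: "l1 \<le> n" for n
  proof -
    define E where "E = exp (15 * sqrt (real n))"
    have "0 < n" using n l1_ge by simp
    then have pos: "0 < real n ^ 2 * E" by (simp add: E_def)
    \<comment> \<open>The count for \<open>late\<close> runs over the \<open>horizon n + 1\<close>
      shifts from 0 to \<open>horizon n\<close>, which makes up for the rounding down.\<close>
    have "real n ^ 2 * E \<le> real (Suc (horizon n))"
      unfolding horizon_def E_def[symmetric] using pos by linarith
    then have "(real n ^ 2 * E) * prob (late n (horizon n)) \<le> real (Suc (horizon n)) * prob (late n (horizon n))"
      by (intro mult_right_mono) auto
    also have "\<dots> \<le> E"
      unfolding E_def using card_late n by (intro prob_le_frequency sets_late) auto
    finally show ?thesis using \<open>0 < n\<close> by (simp add: field_simps E_def)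
  qed
  have "summable (\<lambda>n. 1 / real n ^ 2)"
    using inverse_power_summable[of 2] by (simp add: inverse_eq_divide)
  then have "summable (\<lambda>n. prob (late n (horizon n)))"
    by (rule summable_comparison_test'[where N = l1]) (use bound in auto)
  from borel_cantelli_AE1[OF sets_late _ this] show ?thesis
    by (simp add: emeasure_eq_measure)
qed

lemma limsup_zero_if_not_late:
  fixes \<beta> :: real
  assumes late: "\<forall>\<^sub>F n in sequentially. x \<notin> late n (horizon n)" and \<beta>: "1/2 < \<beta>"
  shows "limsup (\<lambda>n. ereal (ln (real (return_time x n)) / real n powr \<beta>)) = 0"
proof -
  have bounds: "\<forall>\<^sub>F n in sequentially. 0 \<le> ln (real (return_time x n)) \<and>
    ln (real (return_time x n)) \<le> 2 * ln (real n) + 15 * sqrt (real n)"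
    using late eventually_gt_at_top[of 0]
  proof eventually_elim
    case (elim n)
    \<comment> \<open>Outside \<open>late\<close> a return exists, so the \<open>LEAST\<close> is
      attained and bounded by the horizon.\<close>
    then obtain k where k: "0 < k" "k \<le> horizon n" "\<forall>i<n. x (int k + int i) = x (int i)"
      unfolding late_def by auto
    then have "return_time x n \<le> k" "0 < return_time x n"
      unfolding return_time_def
      using Least_le[of "\<lambda>k. 0 < k \<and> (\<forall>i<n. x (int k + int i) = x (int i))" k]
        LeastI[of "\<lambda>k. 0 < k \<and> (\<forall>i<n. x (int k + int i) = x (int i))" k] by auto
    then have R: "1 \<le> real (return_time x n)" "real (return_time x n) \<le> real (horizon n)"
      using k by linarith+
    have "real (horizon n) \<le> real n ^ 2 * exp (15 * sqrt (real n))"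
      unfolding horizon_def by simp
    with R have "ln (real (return_time x n)) \<le> ln (real n ^ 2 * exp (15 * sqrt (real n)))"
      using elim by (subst ln_le_cancel_iff) auto
    also have "\<dots> = 2 * ln (real n) + 15 * sqrt (real n)"
      using elim by (simp add: ln_mult ln_realpow)
    finally show ?case using R by simp
  qed
  have "(\<lambda>n. ln (real (return_time x n)) / real n powr \<beta>) \<longlonglongrightarrow> 0"
  proof (rule tendsto_sandwich[where f = "\<lambda>_. 0"])
    show "\<forall>\<^sub>F n in sequentially. 0 \<le> ln (real (return_time x n)) / real n powr \<beta>"
      using bounds by eventually_elim simp
    show "\<forall>\<^sub>F n in sequentially. ln (real (return_time x n)) / real n powr \<beta>
      \<le> (2 * ln (real n) + 15 * sqrt (real n)) / real n powr \<beta>"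
      using bounds by eventually_elim (simp add: divide_right_mono)
    show "(\<lambda>n. (2 * ln (real n) + 15 * sqrt (real n)) / real n powr \<beta>) \<longlonglongrightarrow> 0"
      using \<beta> by real_asymp
  qed simp
  then have "(\<lambda>n. ereal (ln (real (return_time x n)) / real n powr \<beta>)) \<longlonglongrightarrow> ereal 0"
    by (intro tendsto_ereal)
  from lim_imp_Limsup[OF _ this] show ?thesis by (simp add: zero_ereal_def)
qed

text \<open>A limsup dominates limits along subsequences, and along the scales for
  \<open>\<tau> = 1/2\<close> the quotients diverge for every positive
  \<open>\<beta> < 1/2\<close>.\<close>

lemma limsup_infinite_if_regular:
  fixes \<beta> :: real
  assumes reg: "\<forall>\<^sub>F j in sequentially. x \<notin> irregular j" and \<beta>: "0 < \<beta>" "\<beta> < 1/2"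
  shows "limsup (\<lambda>n. ereal (ln (real (return_time x n)) / real n powr \<beta>)) = \<infinity>"
proof -
  obtain nj :: "nat \<Rightarrow> nat" where nj: "strict_mono nj"
    "\<And>x. \<forall>\<^sub>F j in sequentially. x \<notin> irregular j \<Longrightarrow> has_critical_value_lim
      (\<lambda>\<beta> j. ereal (ln (real (return_time x (nj j))) / real (nj j) powr \<beta>)) (1/2)"
    by (rule critical_value_lim_exists[of "1/2"]) simp_all
  define F where "F n = ereal (ln (real (return_time x n)) / real n powr \<beta>)" for n
  have "(F \<circ> nj) \<longlonglongrightarrow> \<infinity>"
    using nj(2)[OF reg] \<beta> unfolding has_critical_value_lim_def F_def comp_def by blast
  then have "limsup (F \<circ> nj) = \<infinity>" by (intro lim_imp_Limsup) auto
  then have "\<infinity> \<le> limsup F" using limsup_subseq_mono[OF nj(1), of F] by simp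
  then show ?thesis unfolding F_def by simp
qed

lemma limsup_critical_value:
  "AE x in \<mu>. has_critical_value
     (\<lambda>\<beta>. limsup (\<lambda>n. ereal (ln (real (return_time x n)) / real n powr \<beta>))) (1/2)"
  using AE_regular AE_not_late
  by eventually_elim
    (unfold has_critical_value_def, use limsup_zero_if_not_late limsup_infinite_if_regular in blast)

lemma lim_critical_values:
  "\<exists>Xh. Xh \<subseteq> marker_subshift l1 u \<and> Xh \<in> sets \<mu> \<and> emeasure \<mu> Xh = 1 \<and>
    (\<forall>\<tau>::real. 0 \<le> \<tau> \<and> \<tau> \<le> 1/2 \<longrightarrow>
      (\<exists>nj :: nat \<Rightarrow> nat. strict_mono nj \<and>
         (\<forall>x\<in>Xh. has_critical_value_lim
            (\<lambda>\<beta> j. ereal (ln (real (return_time x (nj j))) / real (nj j) powr \<beta>)) \<tau>)))"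
proof -
  define Xh where "Xh = {x \<in> space \<mu>. x \<in> marker_subshift l1 u \<and> (\<exists>k. \<forall>j\<ge>k. x \<notin> irregular j)}"
  have "Xh \<in> sets \<mu>" unfolding Xh_def by measurable
  moreover have "AE x in \<mu>. x \<in> Xh"
    using AE_subshift AE_regular by eventually_elim (simp add: Xh_def eventually_sequentially)
  then have "emeasure \<mu> Xh = 1" using \<open>Xh \<in> sets \<mu>\<close> by (intro emeasure_eq_1_AE)
  moreover have regular: "\<forall>\<^sub>F j in sequentially. x \<notin> irregular j" if "x \<in> Xh" for x
    using that unfolding Xh_def eventually_sequentially by blast
  have "\<exists>nj :: nat \<Rightarrow> nat. strict_mono nj \<and> (\<forall>x\<in>Xh. has_critical_value_lim
      (\<lambda>\<beta> j. ereal (ln (real (return_time x (nj j))) / real (nj j) powr \<beta>)) \<tau>)"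
    if "0 \<le> \<tau> \<and> \<tau> \<le> 1/2" for \<tau> :: real
    by (rule critical_value_lim_exists[of \<tau>]) (use that regular in blast)+
  moreover have "Xh \<subseteq> marker_subshift l1 u" unfolding Xh_def by blast
  ultimately show ?thesis by (intro exI[of _ Xh]) blast
qed

end

theorem theorem4p7:
  "\<exists>L. \<forall>l1 u (\<mu> :: (int \<Rightarrow> bool) measure).
     l1 \<ge> L \<longrightarrow> marker_construction l1 u \<longrightarrow>
     prob_space \<mu> \<longrightarrow>
     sets \<mu> = sets (Pi\<^sub>M UNIV (\<lambda>_::int. count_space (UNIV :: bool set))) \<longrightarrow>
     (AE x in \<mu>. x \<in> marker_subshift l1 u) \<longrightarrow>
     (\<forall>A\<in>sets \<mu>. emeasure \<mu> (shift -` A \<inter> space \<mu>) = emeasure \<mu> A) \<longrightarrow>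
     (AE x in \<mu>. has_critical_value
        (\<lambda>\<beta>. limsup (\<lambda>n. ereal (ln (real (return_time x n)) / real n powr \<beta>))) (1/2))
   \<and> (\<exists>Xh. Xh \<subseteq> marker_subshift l1 u \<and> Xh \<in> sets \<mu> \<and> emeasure \<mu> Xh = 1 \<and>
        (\<forall>\<tau>::real. 0 \<le> \<tau> \<and> \<tau> \<le> 1/2 \<longrightarrow>
          (\<exists>nj :: nat \<Rightarrow> nat. strict_mono nj \<and>
             (\<forall>x\<in>Xh. has_critical_value_lim
                (\<lambda>\<beta> j. ereal (ln (real (return_time x (nj j))) / real (nj j) powr \<beta>)) \<tau>))))"
proof (intro exI[of _ 100] allI impI)
  \<comment> \<open>The threshold 100 gives \<open>isqrt l1 \<ge> 10\<close>, hence at least 1024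
    words at the bottom level, where the growth estimates start.\<close>
  fix l1 u and \<mu> :: "(int \<Rightarrow> bool) measure"
  assume "100 \<le> l1" "marker_construction l1 u" "prob_space \<mu>"
    "sets \<mu> = sets (Pi\<^sub>M UNIV (\<lambda>_::int. count_space (UNIV :: bool set)))"
    "AE x in \<mu>. x \<in> marker_subshift l1 u"
    "\<forall>A\<in>sets \<mu>. emeasure \<mu> (shift -` A \<inter> space \<mu>) = emeasure \<mu> A"
  then interpret marker_measure l1 u \<mu>
    by (intro marker_measure.intro marker.intro marker_measure_axioms.intro)
  show "(AE x in \<mu>. has_critical_value
        (\<lambda>\<beta>. limsup (\<lambda>n. ereal (ln (real (return_time x n)) / real n powr \<beta>))) (1/2))
   \<and> (\<exists>Xh. Xh \<subseteq> marker_subshift l1 u \<and> Xh \<in> sets \<mu> \<and> emeasure \<mu> Xh = 1 \<and>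
        (\<forall>\<tau>::real. 0 \<le> \<tau> \<and> \<tau> \<le> 1/2 \<longrightarrow>
          (\<exists>nj :: nat \<Rightarrow> nat. strict_mono nj \<and>
             (\<forall>x\<in>Xh. has_critical_value_lim
                (\<lambda>\<beta> j. ereal (ln (real (return_time x (nj j))) / real (nj j) powr \<beta>)) \<tau>))))"
    using limsup_critical_value lim_critical_values by blast
qed

end
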